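(* The set $\mathcal{M}_{\mathrm{H}(C)}$ of increasing monomials in the generators $C$ and $\hat y_j^{(r)}$ ($j=1,\dots,N-1$, $r\in\mathbb Z$) forms a topological basis of $\mathrm{H}(C)$ over $\mathbb C[[h]]$ (i.e., it is linearly independent over $\mathbb C[[h]]$ and its $\mathbb C[[h]]$-span is $h$-adically dense in $\mathrm{H}(C)$).
   Context: $N\geqslant 2$ is an integer and $h$ a formal parameter. Expressions $(x_1+\dots+x_n)^r$ with $r<0$ are expanded in nonnegative powers of $x_2,\dots,x_n$. **The series $S$.** Let $R(u)=I-\frac hu P$ on $\mathbb C^N\otimes\mathbb C^N$, $I$ the identity, $P=\sum_{i,j}e_{ij}\otimes e_{ji}$ ($e_{ij}$ matrix units). There is a unique series $G(u,C)=1+\frac{C+N}{N}\frac{h^2}{u^2}-\dots\in\mathbb C[C][[h/u]]$ with $\mathrm{tr}_1(G(u,C)R(u)R(-u-hC)-I)=\mathrm{tr}_2(G(u,C)R(u)R(-u-hC)-I)=0$ ($\mathrm{tr}_i$ is the trace over the $i$-th tensor factor). Put $S(u,C)=h^{-2}(G(u,C)R(u)R(-u-hC)-I)$ and let $s_{ij}(u,C)\in\mathbb C[C,u^{-1}][[h]]$ be the coefficient of $e_{ii}\otimes e_{jj}$ in $S(u,C)$. **The algebra $\mathrm{H}(C)$** is the $h$-adically complete associative algebra over $\mathbb C[[h]]$ generated by a central element $C$ and elements $y_i^{(r)}$, $i=1,\dots,N$, $r\in\mathbb Z$, subject to the relations, written with $y^i(u)=\sum_{r\in\mathbb Z}y_i^{(r)}u^{-r-1}$,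 $$y^i(u)y^j(v)+s_{ij}(u-v,C)=y^j(v)y^i(u)+s_{ij}(v-u,C)\quad(i,j=1,\dots,N),\qquad y^1(u)+\dots+y^N(u)=0.$$ **The generators $\hat y_j^{(r)}$.** Let $\mathfrak h$ be the complex vector space (abelian Lie algebra) spanned by $a_1,\dots,a_N$ with the single relation $a_1+\dots+a_N=0$, with the symmetric bilinear form $\langle a_i,a_j\rangle=\delta_{ij}-\frac1N$. Let $\hat a_1,\dots,\hat a_{N-1}$ be an orthonormal basis of $\mathfrak h$ of the form $\hat a_j=\sum_{i=1}^j\nu_{ij}a_i$, $\nu_{ij}\in\mathbb C$. Put $\hat y_j^{(r)}=\sum_{i=1}^j\nu_{ij}y_i^{(r)}$ for $j=1,\dots,N-1$, $r\in\mathbb Z$. Let $\mathcal G_{\mathrm{H}(C)}=\{C\}\cup\{\hat y_j^{(r)}\}$, with the linear order $C\prec\hat y_j^{(r)}$ for all $j,r$, and $\hat y_i^{(s)}\prec\hat y_j^{(r)}$ if $s<r$, or $s=r$ and $i<j$. $\mathcal M_{\mathrm{H}(C)}$ is the family of all increasing monomials $m_n\cdots m_1$, $n\geqslant0$, with $m_1,\dots,m_n\in\mathcal G_{\mathrm{H}(C)}$ and $m_n\preceq\dots\preceq m_1$ (the empty monomial being $1$). *)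

theory Defs
  imports
    "HOL-Analysis.Analysis"
    "HOL-Computational_Algebra.Polynomial"
    "HOL-Computational_Algebra.Formal_Power_Series"
    "HOL-Library.Poly_Mapping"
begin

text \<open>
  Throughout, the integer \<open>N\<close> is the cardinality of a finite linearly ordered type \<open>'n\<close>,
  whose elements play the role of the indices \<open>1, \<dots>, N\<close>.
\<close>

no_notation fps_nth (infixl \<open>$\<close> 75)

section \<open>The series \<open>S\<close>\<close>

text \<open>
  The ring \<open>\<complex>[C][[x]]\<close>, where \<open>x = h/u\<close>, is \<^typ>\<open>complex poly fps\<close>. Endomorphisms of
  \<open>\<complex>\<^sup>N \<otimes> \<complex>\<^sup>N\<close> with coefficients in this ring are matrices whose rows and columns are
  indexed by pairs.
\<close>

type_synonym 'n tmat = "complex poly fps ^ ('n \<times> 'n) ^ ('n \<times> 'n)"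

definition matrix_unit :: "'n \<Rightarrow> 'n \<Rightarrow> complex poly fps ^ 'n ^ 'n" where
  "matrix_unit i j = (\<chi> a b. if a = i \<and> b = j then 1 else 0)"

definition tensor :: "complex poly fps ^ 'n ^ 'n \<Rightarrow> complex poly fps ^ 'n ^ 'n \<Rightarrow> 'n::finite tmat" where
  "tensor A B = (\<chi> p q. A $ fst p $ fst q * B $ snd p $ snd q)"

definition perm_mat :: "'n::finite tmat" where
  "perm_mat = (\<Sum>i\<in>UNIV. \<Sum>j\<in>UNIV. tensor (matrix_unit i j) (matrix_unit j i))"

text \<open>\<open>R(w) = I - (h/w) P\<close> as a function of \<open>h/w\<close>.\<close>

definition R_mat :: "complex poly fps \<Rightarrow> 'n::finite tmat" where
  "R_mat z = mat 1 - mat z ** perm_mat"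

text \<open>
  The expansion of \<open>h/(-u - hC) = - x (1 + C x)\<^sup>-\<^sup>1\<close> in nonnegative powers of \<open>hC\<close>.
\<close>

definition neg_shift :: "complex poly fps" where
  "neg_shift = - (fps_X * Abs_fps (\<lambda>k. (- [:0, 1:]) ^ k))"

definition RR_mat :: "'n::finite tmat" where
  "RR_mat = R_mat fps_X ** R_mat neg_shift"

definition ptrace1 :: "'n::finite tmat \<Rightarrow> complex poly fps ^ 'n ^ 'n" where
  "ptrace1 M = (\<chi> b d. \<Sum>a\<in>UNIV. M $ (a, b) $ (a, d))"

definition ptrace2 :: "'n::finite tmat \<Rightarrow> complex poly fps ^ 'n ^ 'n" where
  "ptrace2 M = (\<chi> a c. \<Sum>b\<in>UNIV. M $ (a, b) $ (c, b))"

definition is_G :: "'n::finite itself \<Rightarrow> complex poly fps \<Rightarrow> bool" where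
  "is_G _ g \<longleftrightarrow>
     ptrace1 (mat g ** RR_mat - mat 1 :: 'n tmat) = 0 \<and>
     ptrace2 (mat g ** RR_mat - mat 1 :: 'n tmat) = 0"

definition G_series :: "'n::finite itself \<Rightarrow> complex poly fps" where
  "G_series T = (THE g. is_G T g)"

text \<open>The matrix \<open>G(u,C) R(u) R(-u-hC) - I = h\<^sup>2 S(u,C)\<close>.\<close>

definition T_mat :: "'n::finite tmat" where
  "T_mat = mat (G_series TYPE('n)) ** RR_mat - mat 1"

text \<open>
  The ring \<open>\<complex>[C,u\<^sup>-\<^sup>1][[h]]\<close> is \<^typ>\<open>complex poly poly fps\<close>, the outer polynomial variable
  being \<open>u\<^sup>-\<^sup>1\<close>. The map below substitutes \<open>x = h u\<^sup>-\<^sup>1\<close>.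
\<close>

definition subst_h_over_u :: "complex poly fps \<Rightarrow> complex poly poly fps" where
  "subst_h_over_u f = Abs_fps (\<lambda>k. monom (fps_nth f k) k)"

text \<open>The shift divides by \<open>h\<^sup>2\<close>; by \<open>T_mat_low\<close> below nothing is lost.\<close>

definition s_series :: "'n::finite \<Rightarrow> 'n \<Rightarrow> complex poly poly fps" where
  "s_series i j = fps_shift 2 (subst_h_over_u (T_mat $ (i, j) $ (i, j)))"

lemma neg_shift_eq: "neg_shift * (1 + fps_const [:0, 1:] * fps_X) = - fps_X"
proof -
  have "Abs_fps (\<lambda>k. (- [:0, 1:]) ^ k) * (1 + fps_const [:0, 1:] * fps_X) = (1 :: complex poly fps)"
  proof (rule fps_ext)
    fix n
    show "fps_nth (Abs_fps (\<lambda>k. (- [:0, 1:]) ^ k) * (1 + fps_const [:0, 1:] * fps_X)) n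
          = fps_nth (1 :: complex poly fps) n"
      by (cases n) (simp_all add: distrib_left mult.assoc[symmetric])
  qed
  then show ?thesis
    by (simp add: neg_shift_def mult.assoc)
qed

lemma perm_mat_nth: "perm_mat $ p $ q = (if fst p = snd q \<and> snd p = fst q then 1 else 0)"
proof -
  have "perm_mat $ p $ q = (\<Sum>i\<in>UNIV. \<Sum>j\<in>UNIV. if fst p = i then
          (if fst q = j \<and> snd p = j \<and> snd q = i then 1 else 0) else 0)"
    unfolding perm_mat_def tensor_def matrix_unit_def
    by (auto simp: sum_component intro!: sum.cong)
  also have "\<dots> = (\<Sum>i\<in>UNIV. if fst p = i then
          (\<Sum>j\<in>UNIV. if fst q = j \<and> snd p = j \<and> snd q = i then 1 else 0) else 0)"
    by (intro sum.cong) auto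
  also have "\<dots> = (\<Sum>j\<in>UNIV. if fst q = j \<and> snd p = j \<and> snd q = fst p then 1 else 0)"
    by (simp only: sum.delta' finite UNIV_I if_True)
  also have "\<dots> = (if fst p = snd q \<and> snd p = fst q then 1 else 0)"
    by (cases "snd p = fst q \<and> snd q = fst p") (auto intro!: sum.neutral)
  finally show ?thesis .
qed

lemma mat_nth: "mat z $ p $ q = (if p = q then z else 0)"
  by (simp add: mat_def)

lemmas mat_1_nth = mat_nth[of 1]

lemma mat_mult_nth: "(mat z ** M) $ p $ q = z * M $ p $ q"
  for M :: "complex poly fps ^ 'm::finite ^ 'm"
  by (simp add: matrix_matrix_mult_def mat_def mult_delta_left)

lemma perm_mat_mult_nth: "(perm_mat ** M) $ p $ q = M $ (snd p, fst p) $ q" for M :: "'n::finite tmat"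
proof -
  have "(perm_mat ** M) $ p $ q = (\<Sum>k\<in>UNIV. if k = (snd p, fst p) then M $ k $ q else 0)"
    unfolding matrix_matrix_mult_def
    by (auto simp: perm_mat_nth prod_eq_iff intro!: sum.cong)
  then show ?thesis by simp
qed

lemma RR_mat_nth:
  "(RR_mat :: 'n::finite tmat) $ p $ q =
     (1 + fps_X * neg_shift) * (if p = q then 1 else 0)
     - (fps_X + neg_shift) * (if fst p = snd q \<and> snd p = fst q then 1 else 0)"
proof -
  have *: "(A - B) ** M = A ** M - B ** M" for A B M :: "'n tmat"
    by (simp add: matrix_matrix_mult_def vec_eq_iff left_diff_distrib sum_subtractf)
  have RR: "(RR_mat :: 'n tmat) = R_mat neg_shift - mat fps_X ** (perm_mat ** R_mat neg_shift)"
    unfolding RR_mat_def by (simp add: R_mat_def[of fps_X] * matrix_mul_assoc[symmetric])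
  have a: "(R_mat neg_shift - mat fps_X ** (perm_mat ** R_mat neg_shift) :: 'n tmat) $ p $ q =
      R_mat neg_shift $ p $ q - fps_X * (R_mat neg_shift :: 'n tmat) $ (snd p, fst p) $ q"
    by (simp only: vector_minus_component mat_mult_nth perm_mat_mult_nth)
  have b: "(R_mat neg_shift :: 'n tmat) $ p' $ q = (if p' = q then 1 else 0)
      - neg_shift * (if fst p' = snd q \<and> snd p' = fst q then 1 else 0)" for p'
    by (simp only: R_mat_def vector_minus_component mat_mult_nth perm_mat_nth mat_1_nth)
  show ?thesis
    unfolding RR a b prod_eq_iff
    by (cases "snd p = fst q"; cases "fst p = snd q"; cases "fst p = fst q"; cases "snd p = snd q")
       (auto simp: algebra_simps)
qed

definition G_denom :: "'n::finite itself \<Rightarrow> complex poly fps" where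
  "G_denom _ = of_nat CARD('n) * (1 + fps_X * neg_shift) - (fps_X + neg_shift)"

lemma is_G_iff: "is_G TYPE('n::finite) g \<longleftrightarrow> g * G_denom TYPE('n) = of_nat CARD('n)"
proof -
  have delta: "(\<Sum>a\<in>UNIV. if a = b \<and> P then c else 0) = (if P then c else 0)"
              "(\<Sum>a\<in>UNIV. if b = a \<and> P then c else 0) = (if P then c else 0)"
    for b :: 'n and P and c :: "complex poly fps"
    by simp_all
  have t1: "ptrace1 (mat g ** RR_mat - mat 1 :: 'n tmat) =
          mat (g * G_denom TYPE('n) - of_nat CARD('n))"
  proof -
    have "(\<Sum>a\<in>UNIV. (mat g ** RR_mat - mat 1 :: 'n tmat) $ (a, b) $ (a, d)) =
          (\<Sum>a\<in>UNIV. (if b = d then g * (1 + fps_X * neg_shift) - 1 else 0)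
             - (if a = d \<and> b = d then g * (fps_X + neg_shift) else 0))" for b d
      by (intro sum.cong) (auto simp: mat_mult_nth RR_mat_nth mat_1_nth algebra_simps)
    then have "(\<Sum>a\<in>UNIV. (mat g ** RR_mat - mat 1 :: 'n tmat) $ (a, b) $ (a, d)) =
          mat (g * G_denom TYPE('n) - of_nat CARD('n)) $ b $ d" for b d
      by (auto simp only: sum_subtractf delta sum_constant mat_nth G_denom_def)
         (simp_all add: algebra_simps)
    then show ?thesis
      by (simp add: ptrace1_def vec_eq_iff)
  qed
  have t2: "ptrace2 (mat g ** RR_mat - mat 1 :: 'n tmat) =
          mat (g * G_denom TYPE('n) - of_nat CARD('n))"
  proof -
    have "(\<Sum>b\<in>UNIV. (mat g ** RR_mat - mat 1 :: 'n tmat) $ (a, b) $ (c, b)) =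
          (\<Sum>b\<in>UNIV. (if a = c then g * (1 + fps_X * neg_shift) - 1 else 0)
             - (if b = c \<and> a = c then g * (fps_X + neg_shift) else 0))" for a c
      by (intro sum.cong) (auto simp: mat_mult_nth RR_mat_nth mat_1_nth algebra_simps)
    then have "(\<Sum>b\<in>UNIV. (mat g ** RR_mat - mat 1 :: 'n tmat) $ (a, b) $ (c, b)) =
          mat (g * G_denom TYPE('n) - of_nat CARD('n)) $ a $ c" for a c
      by (auto simp only: sum_subtractf delta sum_constant mat_nth G_denom_def)
         (simp_all add: algebra_simps)
    then show ?thesis
      by (simp add: ptrace2_def vec_eq_iff)
  qed
  show ?thesis
    unfolding is_G_def t1 t2 by (auto simp: vec_eq_iff mat_def)
qed

lemma fps_nth_neg_shift:
  "fps_nth neg_shift k = (if k = 0 then 0 else - ((- [:0, 1:]) ^ (k - 1)))"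
  by (simp add: neg_shift_def)

lemma G_denom_nth:
  "fps_nth (G_denom TYPE('n::finite)) 0 = of_nat CARD('n)"
  "fps_nth (G_denom TYPE('n::finite)) 1 = 0"
  "fps_nth (G_denom TYPE('n::finite)) 2 = - of_nat CARD('n) - [:0, 1:]"
  by (simp_all add: G_denom_def fps_nth_neg_shift fps_of_nat[symmetric])

theorem ex1_G: "\<exists>!g. is_G TYPE('n::finite) g"
proof -
  let ?c = "[:1 / of_nat CARD('n):] :: complex poly"
  have "fps_nth (G_denom TYPE('n)) 0 * ?c = 1"
    by (simp add: G_denom_nth of_nat_poly one_pCons)
  then have inv: "G_denom TYPE('n) * fps_right_inverse (G_denom TYPE('n)) ?c = 1"
    by (rule fps_right_inverse)
  have "is_G TYPE('n) (fps_right_inverse (G_denom TYPE('n)) ?c * of_nat CARD('n))"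
    unfolding is_G_iff using inv by (metis mult.commute mult.left_commute mult.right_neutral)
  moreover have "g = g'" if "is_G TYPE('n) g" "is_G TYPE('n) g'" for g g'
  proof -
    have "G_denom TYPE('n) \<noteq> 0" using inv by auto
    then show ?thesis using that unfolding is_G_iff by (metis mult_right_cancel)
  qed
  ultimately show ?thesis by blast
qed

lemma is_G_G_series: "is_G TYPE('n::finite) (G_series TYPE('n))"
  unfolding G_series_def by (rule theI'[OF ex1_G])

lemma G_series_nth:
  "fps_nth (G_series TYPE('n::finite)) 0 = 1"
  "fps_nth (G_series TYPE('n::finite)) 1 = 0"
  "fps_nth (G_series TYPE('n::finite)) 2 = [:1, 1 / of_nat CARD('n):]"
proof -
  let ?N = "of_nat CARD('n) :: complex poly"
  have N: "?N \<noteq> 0" by simp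
  have eq: "fps_nth (G_series TYPE('n) * G_denom TYPE('n)) k = fps_nth (fps_const ?N) k" for k
    using is_G_G_series[where 'n='n] unfolding is_G_iff by (simp add: fps_of_nat)
  show 0: "fps_nth (G_series TYPE('n)) 0 = 1"
    using eq[of 0] N by (simp add: G_denom_nth)
  show 1: "fps_nth (G_series TYPE('n)) 1 = 0"
    using eq[of 1] N G_denom_nth[where 'n='n] by (simp add: fps_mult_nth)
  have "fps_nth (G_series TYPE('n)) 2 * ?N = ?N + [:0, 1:]"
    using eq[of 2] 0 1 G_denom_nth[where 'n='n]
    by (simp add: fps_mult_nth numeral_2_eq_2)
       (simp add: algebra_simps add_eq_0_iff)
  also have "\<dots> = [:1, 1 / of_nat CARD('n):] * ?N"
    by (simp add: of_nat_poly)
  finally show "fps_nth (G_series TYPE('n)) 2 = [:1, 1 / of_nat CARD('n):]"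
    using N by (metis mult_right_cancel)
qed

lemma T_mat_low:
  "fps_nth ((T_mat :: 'n::finite tmat) $ p $ q) 0 = 0"
  "fps_nth ((T_mat :: 'n::finite tmat) $ p $ q) 1 = 0"
  using G_series_nth[where 'n='n]
  by (auto simp: T_mat_def mat_mult_nth RR_mat_nth mat_1_nth fps_mult_nth fps_nth_neg_shift)


section \<open>The algebra \<open>H(C)\<close>\<close>

text \<open>
  The free \<open>\<complex>\<close>-algebra on a set of generators is the monoid algebra (\<open>\<Rightarrow>\<^sub>0\<close> with convolution)
  of the free monoid; power series over it form the \<open>h\<close>-adic completion of the free
  \<open>\<complex>[[h]]\<close>-algebra. As \<^class>\<open>monoid_add\<close> is what convolution requires, the free monoid is
  written additively.
\<close>

datatype 'a free_mon = Word (letters: "'a list")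

instantiation free_mon :: (type) monoid_add
begin
definition "0 = Word []"
definition "v + w = Word (letters v @ letters w)"
instance by standard (auto simp: zero_free_mon_def plus_free_mon_def)
end

datatype 'n gen = GenC | GenY 'n int

type_synonym 'n falg = "('n gen free_mon \<Rightarrow>\<^sub>0 complex) fps"

definition letter :: "'n gen \<Rightarrow> 'n falg" where
  "letter g = fps_const (Poly_Mapping.single (Word [g]) 1)"

definition falg_scalar :: "complex fps \<Rightarrow> 'n falg" where
  "falg_scalar c = Abs_fps (\<lambda>k. Poly_Mapping.single 0 (fps_nth c k))"

text \<open>The canonical map \<open>\<complex>[C][[h]] \<rightarrow> falg\<close>.\<close>

definition eval_C :: "complex poly fps \<Rightarrow> 'n falg" where
  "eval_C f = Abs_fps (\<lambda>k. \<Sum>m\<le>degree (fps_nth f k).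
     Poly_Mapping.single (Word (replicate m GenC)) (coeff (fps_nth f k) m))"

text \<open>
  The coefficient of \<open>u^(-r-1) v^(-s-1)\<close> in
  \<open>(u - v)^(-p) = (\<Sum>k\<ge>0. ((-p) gchoose k) u^(-p-k) (-v)^k)\<close>.
\<close>

definition diff_pow_coeff :: "nat \<Rightarrow> int \<Rightarrow> int \<Rightarrow> complex" where
  "diff_pow_coeff p r s =
     (if s \<le> -1 \<and> r + 1 = int p + (- s - 1)
      then ((- of_nat p) gchoose nat (- s - 1)) * (-1) ^ nat (- s - 1) else 0)"

text \<open>
  The coefficient of \<open>u^(-r-1) v^(-s-1)\<close> in \<open>s\<^sub>i\<^sub>j(u - v, C)\<close>. Interchanging \<open>u\<close> and \<open>v\<close>, the same
  coefficient in \<open>s\<^sub>i\<^sub>j(v - u, C)\<close> is \<open>s_coeff i j s r\<close>.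
\<close>

definition s_coeff :: "'n::finite \<Rightarrow> 'n \<Rightarrow> int \<Rightarrow> int \<Rightarrow> complex poly fps" where
  "s_coeff i j r s = Abs_fps (\<lambda>k. \<Sum>p\<le>degree (fps_nth (s_series i j) k).
     smult (diff_pow_coeff p r s) (coeff (fps_nth (s_series i j) k) p))"

text \<open>
  The relations between the series \<open>y\<^sup>i(u) = (\<Sum>r. y\<^sub>i\<^sup>r u^(-r-1))\<close> are imposed coefficientwise;
  \<open>exchange\<close> is the coefficient of \<open>u^(-r-1) v^(-s-1)\<close>.
\<close>

inductive_set relators :: "'n::finite falg set" where
  central: "letter GenC * x - x * letter GenC \<in> relators"
| exchange:
    "(letter (GenY i r) * letter (GenY j s) + eval_C (s_coeff i j r s))
     - (letter (GenY j s) * letter (GenY i r) + eval_C (s_coeff i j s r)) \<in> relators"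
| sum_zero: "(\<Sum>i\<in>UNIV. letter (GenY i r)) \<in> relators"

inductive_set two_sided_ideal :: "'a::ring_1 set \<Rightarrow> 'a set" for A where
  zero: "0 \<in> two_sided_ideal A"
| step: "a \<in> A \<Longrightarrow> y \<in> two_sided_ideal A \<Longrightarrow> x * a * x' + y \<in> two_sided_ideal A"

definition hadic_closure :: "'a::ring_1 fps set \<Rightarrow> 'a fps set" where
  "hadic_closure I = {x. \<forall>n. \<exists>y\<in>I. \<exists>z. x - y = fps_X ^ n * z}"

text \<open>Taking the closure makes the quotient \<open>h\<close>-adically separated.\<close>

definition hc_ideal :: "'n::finite falg set" where
  "hc_ideal = hadic_closure (two_sided_ideal relators)"

lemma two_sided_ideal_add:
  "x \<in> two_sided_ideal A \<Longrightarrow> y \<in> two_sided_ideal A \<Longrightarrow> x + y \<in> two_sided_ideal A"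
  by (induction rule: two_sided_ideal.induct)
     (auto intro: two_sided_ideal.intros simp: add.assoc)

lemma two_sided_ideal_mult:
  "x \<in> two_sided_ideal A \<Longrightarrow> b * x * c \<in> two_sided_ideal A"
proof (induction rule: two_sided_ideal.induct)
  case (step a y x x')
  have "(b * x) * a * (x' * c) + b * y * c \<in> two_sided_ideal A"
    using step by (intro two_sided_ideal.step) auto
  then show ?case by (simp add: algebra_simps)
qed (simp add: two_sided_ideal.zero)

lemma two_sided_ideal_superset: "A \<subseteq> two_sided_ideal A"
  using two_sided_ideal.step[OF _ two_sided_ideal.zero, of _ A 1 1] by auto

lemma hc_ideal_zero: "0 \<in> hc_ideal"
  unfolding hc_ideal_def hadic_closure_def
  by (auto intro!: bexI[OF _ two_sided_ideal.zero] exI[of _ 0])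

lemma hc_ideal_add:
  assumes "x \<in> hc_ideal" "y \<in> hc_ideal"
  shows "x + y \<in> hc_ideal"
  unfolding hc_ideal_def hadic_closure_def
proof (intro CollectI allI)
  fix n
  obtain a b c d where *: "a \<in> two_sided_ideal relators" "x - a = fps_X ^ n * b"
      "c \<in> two_sided_ideal relators" "y - c = fps_X ^ n * d"
    using assms unfolding hc_ideal_def hadic_closure_def by blast
  have "x + y - (a + c) = fps_X ^ n * (b + d)"
    using *(2,4) by (simp add: algebra_simps)
  then show "\<exists>w\<in>two_sided_ideal relators. \<exists>z. x + y - w = fps_X ^ n * z"
    using two_sided_ideal_add[OF *(1,3)] by blast
qed

lemma hc_ideal_mult:
  assumes "x \<in> hc_ideal"
  shows "b * x * c \<in> hc_ideal"
  unfolding hc_ideal_def hadic_closure_def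
proof (intro CollectI allI)
  fix n
  obtain a d where *: "a \<in> two_sided_ideal relators" "x - a = fps_X ^ n * d"
    using assms unfolding hc_ideal_def hadic_closure_def by blast
  have "b * x * c - b * a * c = b * (x - a) * c" by (simp add: algebra_simps)
  also have "\<dots> = fps_X ^ n * (b * d * c)"
    by (simp only: *(2) mult.assoc[symmetric] fps_mult_fps_X_power_commute[of n b])
  finally show "\<exists>w\<in>two_sided_ideal relators. \<exists>z. b * x * c - w = fps_X ^ n * z"
    using two_sided_ideal_mult[OF *(1)] by blast
qed

lemma hc_ideal_uminus: "x \<in> hc_ideal \<Longrightarrow> - x \<in> hc_ideal"
  using hc_ideal_mult[of x "-1" 1] by simp

lemma hc_ideal_diff: "x \<in> hc_ideal \<Longrightarrow> y \<in> hc_ideal \<Longrightarrow> x - y \<in> hc_ideal"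
  using hc_ideal_add[of x "- y"] hc_ideal_uminus[of y] by simp

lemma hc_ideal_left: "x \<in> hc_ideal \<Longrightarrow> b * x \<in> hc_ideal"
  using hc_ideal_mult[of x b 1] by simp

lemma hc_ideal_right: "x \<in> hc_ideal \<Longrightarrow> x * c \<in> hc_ideal"
  using hc_ideal_mult[of x 1 c] by simp

quotient_type (overloaded) 'n hc = "'n::finite falg" / "\<lambda>x y. x - y \<in> hc_ideal"
proof (rule equivpI)
  show "reflp (\<lambda>x y :: 'n falg. x - y \<in> hc_ideal)"
    by (simp add: reflp_def hc_ideal_zero)
  show "symp (\<lambda>x y :: 'n falg. x - y \<in> hc_ideal)"
    unfolding symp_def using hc_ideal_uminus by force
  show "transp (\<lambda>x y :: 'n falg. x - y \<in> hc_ideal)"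
  proof (rule transpI)
    fix x y z :: "'n falg"
    assume "x - y \<in> hc_ideal" "y - z \<in> hc_ideal"
    from hc_ideal_add[OF this] show "x - z \<in> hc_ideal" by simp
  qed
qed

instantiation hc :: (finite) "{ring, monoid_mult}"
begin

lift_definition zero_hc :: "'a hc" is 0 .
lift_definition one_hc :: "'a hc" is 1 .
lift_definition plus_hc :: "'a hc \<Rightarrow> 'a hc \<Rightarrow> 'a hc" is "(+)"
  subgoal for x y z w using hc_ideal_add[of "x - y" "z - w"] by (simp add: algebra_simps) done
lift_definition minus_hc :: "'a hc \<Rightarrow> 'a hc \<Rightarrow> 'a hc" is "(-)"
  subgoal for x y z w using hc_ideal_diff[of "x - y" "z - w"] by (simp add: algebra_simps) done
lift_definition uminus_hc :: "'a hc \<Rightarrow> 'a hc" is uminus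
  subgoal for x y using hc_ideal_uminus[of "x - y"] by simp done
lift_definition times_hc :: "'a hc \<Rightarrow> 'a hc \<Rightarrow> 'a hc" is "(*)"
  subgoal for x y z w
    using hc_ideal_add[OF hc_ideal_right[of "x - y" z] hc_ideal_left[of "z - w" y]]
    by (simp add: algebra_simps) done

instance
  by standard (transfer; simp add: algebra_simps hc_ideal_zero)+

end

lift_definition hc_scale :: "complex fps \<Rightarrow> 'n::finite hc \<Rightarrow> 'n hc" is
  "\<lambda>c x. falg_scalar c * x"
  subgoal for c x y using hc_ideal_left[of "x - y" "falg_scalar c"] by (simp add: algebra_simps) done

lemma falg_scalar_simps:
  "falg_scalar 1 = (1 :: 'n falg)"
  "falg_scalar (c + d) = (falg_scalar c + falg_scalar d :: 'n falg)"
  "falg_scalar (c * d) = (falg_scalar c * falg_scalar d :: 'n falg)"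
  "falg_scalar (fps_X ^ n) = (fps_X ^ n :: 'n falg)"
proof -
  have single0_sum: "Poly_Mapping.single (0 :: 'n gen free_mon) (\<Sum>i\<in>A. f i) =
      (\<Sum>i\<in>A. Poly_Mapping.single 0 (f i))"
    for A and f :: "nat \<Rightarrow> complex"
    by (induction A rule: infinite_finite_induct) (simp_all add: single_add)
  show "falg_scalar 1 = (1 :: 'n falg)"
    by (simp add: falg_scalar_def fps_eq_iff)
  show "falg_scalar (c + d) = (falg_scalar c + falg_scalar d :: 'n falg)"
    by (simp add: falg_scalar_def fps_eq_iff single_add)
  show "falg_scalar (c * d) = (falg_scalar c * falg_scalar d :: 'n falg)"
    by (rule fps_ext)
       (simp only: falg_scalar_def fps_nth_Abs_fps fps_mult_nth single0_sum mult_single add_0_left)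
  show "falg_scalar (fps_X ^ n) = (fps_X ^ n :: 'n falg)"
    by (simp add: falg_scalar_def fps_eq_iff)
qed

interpretation hc: module "hc_scale :: complex fps \<Rightarrow> 'n::finite hc \<Rightarrow> 'n hc"
  by unfold_locales
     (transfer; simp add: falg_scalar_simps algebra_simps hc_ideal_zero)+

lift_definition hc_C :: "'n::finite hc" is "letter GenC" .

lift_definition hc_y :: "'n::finite \<Rightarrow> int \<Rightarrow> 'n hc" is "\<lambda>i r. letter (GenY i r)" .

text \<open>The quotient is indeed \<open>h\<close>-adically separated and complete.\<close>

lemma hc_separated:
  fixes x :: "'n::finite hc"
  assumes "\<And>n. \<exists>z. x = hc_scale (fps_X ^ n) z"
  shows "x = 0"
  using assms
proof transfer
  fix x :: "'n falg"
  assume *: "\<And>n. \<exists>z. x - falg_scalar (fps_X ^ n) * z \<in> hc_ideal"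
  show "x - 0 \<in> hc_ideal"
    unfolding hc_ideal_def hadic_closure_def
  proof (intro CollectI allI)
    fix n
    obtain z where "x - fps_X ^ n * z \<in> hc_ideal"
      using *[of n] by (auto simp: falg_scalar_simps)
    then obtain y w where y: "y \<in> two_sided_ideal relators" "x - fps_X ^ n * z - y = fps_X ^ n * w"
      unfolding hc_ideal_def hadic_closure_def by blast
    have "x - 0 - y = fps_X ^ n * (z + w)" using y(2) by (simp add: algebra_simps)
    then show "\<exists>y\<in>two_sided_ideal relators. \<exists>z. x - 0 - y = fps_X ^ n * z"
      using y(1) by blast
  qed
qed

lemma hc_complete:
  fixes X :: "nat \<Rightarrow> 'n::finite hc"
  assumes "\<And>n. \<exists>z. X (Suc n) - X n = hc_scale (fps_X ^ n) z"
  shows "\<exists>L. \<forall>n. \<exists>z. L - X n = hc_scale (fps_X ^ n) z"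
proof -
  obtain d where d: "\<And>n. X (Suc n) - X n = hc_scale (fps_X ^ n) (d n)"
    using assms by metis
  have ex: "\<exists>y. x = abs_hc y" for x :: "'n hc"
    by (induction x rule: hc.abs_induct) blast
  obtain x0 where x0: "X 0 = abs_hc x0"
    using ex by blast
  obtain e where e: "\<And>n. d n = abs_hc (e n)"
    using choice[of "\<lambda>n y. d n = abs_hc y"] ex by blast
  define Z where "Z m = Abs_fps (\<lambda>k. \<Sum>i\<le>k. fps_nth (e (m + i)) (k - i))" for m
  have Z: "Z m = e m + fps_X * Z (Suc m)" for m
  proof (rule fps_ext)
    fix k show "fps_nth (Z m) k = fps_nth (e m + fps_X * Z (Suc m)) k"
      by (cases k) (simp_all add: Z_def sum.atMost_Suc_shift del: sum.atMost_Suc)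
  qed
  have X: "X n + hc_scale (fps_X ^ n) (abs_hc (Z n)) = abs_hc (x0 + Z 0)" for n
  proof (induction n)
    case 0
    then show ?case by (simp add: x0 plus_hc.abs_eq)
  next
    case (Suc n)
    have "X (Suc n) = X n + hc_scale (fps_X ^ n) (abs_hc (e n))"
      using d[of n] e[of n] by (metis add.commute diff_add_cancel)
    moreover have "hc_scale (fps_X ^ Suc n) (abs_hc (Z (Suc n)))
        = hc_scale (fps_X ^ n) (abs_hc (fps_X * Z (Suc n)))"
      unfolding hc_scale.abs_eq falg_scalar_simps
      by (simp add: mult.assoc power_Suc2 del: power_Suc)
    ultimately have "X (Suc n) + hc_scale (fps_X ^ Suc n) (abs_hc (Z (Suc n))) =
        X n + hc_scale (fps_X ^ n) (abs_hc (e n) + abs_hc (fps_X * Z (Suc n)))"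
      by (simp add: hc.scale_right_distrib add.assoc)
    also have "abs_hc (e n) + abs_hc (fps_X * Z (Suc n)) = abs_hc (Z n)"
      by (simp add: plus_hc.abs_eq Z[of n])
    finally show ?case using Suc.IH by simp
  qed
  show ?thesis
    by (rule exI[of _ "abs_hc (x0 + Z 0)"]) (metis X add_diff_cancel_left')
qed


section \<open>The space \<open>\<hh>\<close> and the generators \<open>y-hat\<close>\<close>

text \<open>
  Modulo the constant vectors, the only linear relation between the images \<open>a\<^sub>i\<close> of the standard
  basis vectors is \<open>a\<^sub>1 + \<dots> + a\<^sub>N = 0\<close>. The form is complex bilinear, not Hermitian.
\<close>

quotient_type 'n cartan = "complex ^ 'n" / "\<lambda>x y. \<exists>c. x - y = (\<chi> i. c)"
proof (rule equivpI)
  show "reflp (\<lambda>x y :: complex ^ 'n. \<exists>c. x - y = (\<chi> i. c))"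
    by (auto simp: reflp_def vec_eq_iff)
  show "symp (\<lambda>x y :: complex ^ 'n. \<exists>c. x - y = (\<chi> i. c))"
    unfolding symp_def vec_eq_iff by (auto, metis minus_diff_eq)
  show "transp (\<lambda>x y :: complex ^ 'n. \<exists>c. x - y = (\<chi> i. c))"
  proof (rule transpI)
    fix x y z :: "complex ^ 'n"
    assume "\<exists>c. x - y = (\<chi> i. c)" "\<exists>c. y - z = (\<chi> i. c)"
    then obtain c d where "x - y = (\<chi> i. c)" "y - z = (\<chi> i. d)" by blast
    then have "x - z = (\<chi> i. c + d)" by (simp add: vec_eq_iff algebra_simps)
    then show "\<exists>c. x - z = (\<chi> i. c)" by blast
  qed
qed

instantiation cartan :: (finite) ab_group_add
begin

lift_definition zero_cartan :: "'a cartan" is 0 .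
lift_definition plus_cartan :: "'a cartan \<Rightarrow> 'a cartan \<Rightarrow> 'a cartan" is "(+)"
proof -
  fix x y z w :: "complex ^ 'a"
  assume "\<exists>c. x - y = (\<chi> i. c)" "\<exists>c. z - w = (\<chi> i. c)"
  then obtain c d where "x - y = (\<chi> i. c)" "z - w = (\<chi> i. d)" by blast
  then have "x + z - (y + w) = (\<chi> i. c + d)" by (simp add: vec_eq_iff algebra_simps)
  then show "\<exists>c. x + z - (y + w) = (\<chi> i. c)" by blast
qed
lift_definition minus_cartan :: "'a cartan \<Rightarrow> 'a cartan \<Rightarrow> 'a cartan" is "(-)"
proof -
  fix x y z w :: "complex ^ 'a"
  assume "\<exists>c. x - y = (\<chi> i. c)" "\<exists>c. z - w = (\<chi> i. c)"
  then obtain c d where "x - y = (\<chi> i. c)" "z - w = (\<chi> i. d)" by blast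
  then have "x - z - (y - w) = (\<chi> i. c - d)" by (simp add: vec_eq_iff algebra_simps)
  then show "\<exists>c. x - z - (y - w) = (\<chi> i. c)" by blast
qed
lift_definition uminus_cartan :: "'a cartan \<Rightarrow> 'a cartan" is uminus
proof -
  fix x y :: "complex ^ 'a"
  assume "\<exists>c. x - y = (\<chi> i. c)"
  then obtain c where "x - y = (\<chi> i. c)" by blast
  then have "- x - - y = (\<chi> i. - c)" by (simp add: vec_eq_iff algebra_simps)
  then show "\<exists>c. - x - - y = (\<chi> i. c)" by blast
qed

instance
  by standard (transfer; rule exI[of _ 0]; simp add: vec_eq_iff)+

end

lift_definition cartan_scale :: "complex \<Rightarrow> 'n::finite cartan \<Rightarrow> 'n cartan" is "(*s)"
proof -
  fix a :: complex and x y :: "complex ^ 'n"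
  assume "\<exists>c. x - y = (\<chi> i. c)"
  then obtain c where "x - y = (\<chi> i. c)" by blast
  then have "a *s x - a *s y = (\<chi> i. a * c)"
    by (simp add: vec_eq_iff right_diff_distrib[symmetric])
  then show "\<exists>c. a *s x - a *s y = (\<chi> i. c)" by blast
qed

interpretation cartan: vector_space "cartan_scale :: complex \<Rightarrow> 'n::finite cartan \<Rightarrow> 'n cartan"
  by unfold_locales
     (transfer; rule exI[of _ 0]; simp add: vec_eq_iff algebra_simps)+

lift_definition cartan_a :: "'n::finite \<Rightarrow> 'n cartan" is "\<lambda>i. axis i 1" .

lift_definition cartan_form :: "'n::finite cartan \<Rightarrow> 'n cartan \<Rightarrow> complex" is
  "\<lambda>x y. \<Sum>i\<in>UNIV. \<Sum>j\<in>UNIV. x $ i * y $ j * ((if i = j then 1 else 0) - 1 / of_nat CARD('n))"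
proof -
  define B :: "complex ^ 'n \<Rightarrow> complex ^ 'n \<Rightarrow> complex" where
    "B x y = (\<Sum>i\<in>UNIV. \<Sum>j\<in>UNIV. x $ i * y $ j * ((if i = j then 1 else 0) - 1 / of_nat CARD('n)))" for x y
  have B: "B x y = (\<Sum>i\<in>UNIV. x $ i * y $ i) - (\<Sum>i\<in>UNIV. x $ i) * (\<Sum>i\<in>UNIV. y $ i) / of_nat CARD('n)" for x y
  proof -
    have "B x y = (\<Sum>i\<in>UNIV. \<Sum>j\<in>UNIV. (if i = j then x $ i * y $ j else 0) - x $ i * y $ j / of_nat CARD('n))"
      unfolding B_def by (intro sum.cong) (auto simp: algebra_simps)
    also have "\<dots> = (\<Sum>i\<in>UNIV. x $ i * y $ i) - (\<Sum>i\<in>UNIV. x $ i) * (\<Sum>i\<in>UNIV. y $ i) / of_nat CARD('n)"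
      by (simp add: sum_subtractf sum_product sum_divide_distrib)
    finally show ?thesis .
  qed
  fix x x' y y' :: "complex ^ 'n"
  assume "\<exists>c. x - x' = (\<chi> i. c)" "\<exists>c. y - y' = (\<chi> i. c)"
  then obtain c d where "x = (\<chi> i. x' $ i + c)" "y = (\<chi> i. y' $ i + d)"
    by (auto simp: vec_eq_iff algebra_simps)
  then have "B x y = B x' y'"
    by (simp add: B sum.distrib algebra_simps sum_distrib_left[symmetric] add_divide_distrib)
  then show "(\<Sum>i\<in>UNIV. \<Sum>j\<in>UNIV. x $ i * y $ j * ((if i = j then 1 else 0) - 1 / of_nat CARD('n))) =
    (\<Sum>i\<in>UNIV. \<Sum>j\<in>UNIV. x' $ i * y' $ j * ((if i = j then 1 else 0) - 1 / of_nat CARD('n)))"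
    by (simp add: B_def)
qed

lemma cartan_form_a:
  "cartan_form (cartan_a i) (cartan_a j :: 'n::finite cartan) = (if i = j then 1 else 0) - 1 / of_nat CARD('n)"
proof -
  have "(\<Sum>k\<in>UNIV. \<Sum>l\<in>UNIV. axis i (1::complex) $ k * axis j 1 $ l * ((if k = l then 1 else 0) - 1 / of_nat CARD('n)))
      = (\<Sum>k\<in>UNIV. if k = i then (\<Sum>l\<in>UNIV. if l = j then (if k = l then 1 else 0) - 1 / of_nat CARD('n) else 0) else (0::complex))"
    by (intro sum.cong refl) (auto simp: axis_def mult_delta_left)
  then show ?thesis by transfer simp
qed

text \<open>The indices \<open>1, \<dots>, N - 1\<close>.\<close>

definition low_indices :: "'n::{finite,linorder} set" where
  "low_indices = {..<Max UNIV}"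

text \<open>Only the entries \<open>\<nu> i j\<close> with \<open>i \<le> j\<close> are used.\<close>

definition cartan_hat :: "('n::{finite,linorder} \<Rightarrow> 'n \<Rightarrow> complex) \<Rightarrow> 'n \<Rightarrow> 'n cartan" where
  "cartan_hat \<nu> j = (\<Sum>i\<in>{..j}. cartan_scale (\<nu> i j) (cartan_a i))"

definition orthonormal_basis_coeffs :: "('n::{finite,linorder} \<Rightarrow> 'n \<Rightarrow> complex) \<Rightarrow> bool" where
  "orthonormal_basis_coeffs \<nu> \<longleftrightarrow>
     inj_on (cartan_hat \<nu>) low_indices \<and>
     cartan.independent (cartan_hat \<nu> ` low_indices) \<and>
     cartan.span (cartan_hat \<nu> ` low_indices) = UNIV \<and>
     (\<forall>j\<in>low_indices. \<forall>k\<in>low_indices.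
        cartan_form (cartan_hat \<nu> j) (cartan_hat \<nu> k) = (if j = k then 1 else 0))"

definition hc_y_hat :: "('n::{finite,linorder} \<Rightarrow> 'n \<Rightarrow> complex) \<Rightarrow> 'n \<Rightarrow> int \<Rightarrow> 'n hc" where
  "hc_y_hat \<nu> j r = (\<Sum>i\<in>{..j}. hc_scale (fps_const (\<nu> i j)) (hc_y i r))"


section \<open>Increasing monomials\<close>

datatype 'n hat_gen = HatC | HatY 'n int

definition hat_gens :: "'n::{finite,linorder} hat_gen set" where
  "hat_gens = insert HatC {HatY j r | j r. j \<in> low_indices}"

fun hat_le :: "'n::linorder hat_gen \<Rightarrow> 'n hat_gen \<Rightarrow> bool" where
  "hat_le HatC _ \<longleftrightarrow> True"
| "hat_le (HatY _ _) HatC \<longleftrightarrow> False"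
| "hat_le (HatY i s) (HatY j r) \<longleftrightarrow> s < r \<or> (s = r \<and> i \<le> j)"

fun hat_value :: "('n::{finite,linorder} \<Rightarrow> 'n \<Rightarrow> complex) \<Rightarrow> 'n hat_gen \<Rightarrow> 'n hc" where
  "hat_value \<nu> HatC = hc_C"
| "hat_value \<nu> (HatY j r) = hc_y_hat \<nu> j r"

text \<open>The list \<open>[m\<^sub>n, \<dots>, m\<^sub>1]\<close> encodes the monomial \<open>m\<^sub>n \<cdots> m\<^sub>1\<close>.\<close>

definition increasing_words :: "'n::{finite,linorder} hat_gen list set" where
  "increasing_words = {ms. set ms \<subseteq> hat_gens \<and> sorted_wrt hat_le ms}"

definition hc_monomial :: "('n::{finite,linorder} \<Rightarrow> 'n \<Rightarrow> complex) \<Rightarrow> 'n hat_gen list \<Rightarrow> 'n hc" where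
  "hc_monomial \<nu> ms = prod_list (map (hat_value \<nu>) ms)"

definition hc_dense :: "'n::finite hc set \<Rightarrow> bool" where
  "hc_dense D \<longleftrightarrow> (\<forall>x n. \<exists>y\<in>D. \<exists>z. x - y = hc_scale (fps_X ^ n) z)"

text \<open>
  A topological basis given as an indexed family: distinct indices have distinct values, the
  values are linearly independent over \<open>\<complex>[[h]]\<close>, and their span is \<open>h\<close>-adically dense.
\<close>

definition hc_topological_basis :: "'i set \<Rightarrow> ('i \<Rightarrow> 'n::finite hc) \<Rightarrow> bool" where
  "hc_topological_basis I b \<longleftrightarrow>
     inj_on b I \<and> hc.independent (b ` I) \<and> hc_dense (hc.span (b ` I))"

end

theory Submission
  imports Defs "HOL-Library.Multiset"
begin

text \<open>
  The generators satisfy \<open>[y_a, y_b] = \<omega>(a, b)\<close> with a central antisymmetric \<open>\<omega>\<close>, so this is a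
  Poincare-Birkhoff-Witt theorem for a Heisenberg algebra over \<open>\<complex>[C][[h]]\<close>. Spanning is the usual
  reordering: swapping two neighbouring letters costs a central factor times a word with two
  letters fewer. For independence, let the algebra act on all functions \<open>f\<close> from finite multisets of
  letters to \<open>\<complex>[C][[h]]\<close> by
  \<open>(y_a f)(m) = f(m + a) - (\<Sum>c\<in>m, c > a. \<omega>(a, c) f(m - c))\<close>,
  which is the transpose of the Fock representation; using all functions, not just finitely
  supported ones, makes every sum finite. An increasing word then sends \<open>f\<close> to a function whose value
  at the empty multiset is \<open>C\<^sup>k f(m)\<close>, where \<open>C\<^sup>k m\<close> is the content of the word, and indicator
  functions \<open>f\<close> separate the words. Nothing but the antisymmetry of \<open>\<omega>\<close> and its compatibility with
  \<open>y\<^sub>1 + \<dots> + y\<^sub>N = 0\<close> is used about the series \<open>S\<close>.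
\<close>

section \<open>Actions of the completed free algebra\<close>

text \<open>The \<open>h\<close>-adically convergent series \<open>\<Sum>i. h\<^sup>i g\<^sub>i\<close>.\<close>

definition hsum :: "(nat \<Rightarrow> 'r::comm_ring_1 fps) \<Rightarrow> 'r fps" where
  "hsum g = Abs_fps (\<lambda>k. \<Sum>i\<le>k. fps_nth (g i) (k - i))"

section \<open>Rearranging \<open>h\<close>-adically convergent series\<close>

lemma sum_triangle_swap:
  fixes F :: "nat \<Rightarrow> nat \<Rightarrow> 'a::comm_monoid_add"
  shows "(\<Sum>i\<le>k. \<Sum>j\<le>k - i. F i j) = (\<Sum>n\<le>k. \<Sum>i\<le>n. F i (n - i))"
proof -
  have "(\<Sum>i\<le>k. \<Sum>j\<le>k - i. F i j) = (\<Sum>(i, j)\<in>{(i, j). i + j \<le> k}. F i j)"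
    by (subst sum.Sigma) (auto intro!: sum.cong)
  then show ?thesis
    by (simp add: sum.triangle_reindex_eq)
qed

lemma sum_atMost_reverse:
  fixes F :: "nat \<Rightarrow> nat \<Rightarrow> 'a::comm_monoid_add"
  shows "(\<Sum>i\<le>n. F i (n - i)) = (\<Sum>i\<le>n. F (n - i) i)"
  by (rule sum.reindex_bij_witness[of _ "\<lambda>i. n - i" "\<lambda>i. n - i"]) auto

lemma hsum_add: "hsum (\<lambda>i. f i + g i) = hsum f + hsum g"
  by (rule fps_ext) (simp add: hsum_def sum.distrib)

lemma hsum_sum: "finite K \<Longrightarrow> hsum (\<lambda>i. \<Sum>j\<in>K. f j i) = (\<Sum>j\<in>K. hsum (f j))"
  by (rule fps_ext) (simp add: hsum_def fps_sum_nth sum.swap[of _ _ K])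

lemma hsum_mult: "hsum (\<lambda>i. r * g i) = r * hsum g"
proof (rule fps_ext)
  fix k
  have "fps_nth (r * hsum g) k = (\<Sum>j\<le>k. \<Sum>i\<le>k - j. fps_nth r j * fps_nth (g i) (k - j - i))"
    by (simp add: hsum_def fps_mult_nth sum_distrib_left atLeast0AtMost)
  also have "\<dots> = (\<Sum>n\<le>k. \<Sum>i\<le>n. fps_nth r i * fps_nth (g (n - i)) (k - n))"
    by (subst sum_triangle_swap) (auto intro!: sum.cong)
  also have "\<dots> = (\<Sum>n\<le>k. \<Sum>i\<le>n. fps_nth r (n - i) * fps_nth (g i) (k - n))"
    by (intro sum.cong refl sum_atMost_reverse)
  also have "\<dots> = (\<Sum>i\<le>k. \<Sum>j\<le>k - i. fps_nth r j * fps_nth (g i) (k - i - j))"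
    by (subst sum_triangle_swap) (auto intro!: sum.cong)
  finally show "fps_nth (hsum (\<lambda>i. r * g i)) k = fps_nth (r * hsum g) k"
    by (simp add: hsum_def fps_mult_nth atLeast0AtMost)
qed

text \<open>Grouping by total degree \<open>n\<close> turns a double series into a single one; later
  this matches the Cauchy product in the free algebra.\<close>

lemma hsum_hsum: "hsum (\<lambda>i. hsum (\<lambda>j. g i j)) = hsum (\<lambda>n. \<Sum>i\<le>n. g i (n - i))"
proof (rule fps_ext)
  fix k
  have "fps_nth (hsum (\<lambda>i. hsum (\<lambda>j. g i j))) k
      = (\<Sum>i\<le>k. \<Sum>j\<le>k - i. fps_nth (g i j) (k - i - j))"
    by (simp add: hsum_def)
  also have "\<dots> = (\<Sum>n\<le>k. \<Sum>i\<le>n. fps_nth (g i (n - i)) (k - n))"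
    by (subst sum_triangle_swap) (auto intro!: sum.cong)
  finally show "fps_nth (hsum (\<lambda>i. hsum (\<lambda>j. g i j))) k = fps_nth (hsum (\<lambda>n. \<Sum>i\<le>n. g i (n - i))) k"
    by (simp add: hsum_def fps_sum_nth)
qed

lemma hsum_const: "hsum (\<lambda>i. fps_const (fps_nth r i)) = r"
proof (rule fps_ext)
  fix k
  have "(\<Sum>i\<le>k. fps_nth (fps_const (fps_nth r i)) (k - i)) = (\<Sum>i\<le>k. if i = k then fps_nth r i else 0)"
    by (intro sum.cong) auto
  then show "fps_nth (hsum (\<lambda>i. fps_const (fps_nth r i))) k = fps_nth r k"
    by (simp add: hsum_def)
qed

lemma hsum_shift: "hsum (\<lambda>i. if n \<le> i then g (i - n) else 0) = fps_X ^ n * hsum g"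
proof (rule fps_ext)
  fix k
  show "fps_nth (hsum (\<lambda>i. if n \<le> i then g (i - n) else 0)) k = fps_nth (fps_X ^ n * hsum g) k"
  proof (cases "k < n")
    case False
    have "(\<Sum>i\<le>k. fps_nth (if n \<le> i then g (i - n) else 0) (k - i))
        = (\<Sum>i\<in>{n..k}. fps_nth (g (i - n)) (k - i))"
      by (rule sum.mono_neutral_cong_right) auto
    also have "\<dots> = (\<Sum>i\<le>k - n. fps_nth (g i) (k - n - i))"
      using False by (intro sum.reindex_bij_witness[of _ "\<lambda>i. i + n" "\<lambda>i. i - n"]) auto
    finally show ?thesis
      using False by (simp add: hsum_def fps_X_power_mult_nth)
  qed (auto simp: hsum_def fps_X_power_mult_nth intro!: sum.neutral)
qed

section \<open>Linear and \<open>h\<close>-adically continuous operators\<close>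

text \<open>The third clause is \<open>h\<close>-adic continuity; it lets an operator pass through
  the infinite sum that defines \<open>fps_act\<close>.\<close>

definition hlin :: "(('s \<Rightarrow> 'r::comm_ring_1 fps) \<Rightarrow> 's \<Rightarrow> 'r fps) \<Rightarrow> bool" where
  "hlin T \<longleftrightarrow> (\<forall>f g. T (\<lambda>m. f m + g m) = (\<lambda>m. T f m + T g m)) \<and>
     (\<forall>r f. T (\<lambda>m. r * f m) = (\<lambda>m. r * T f m)) \<and>
     (\<forall>g. T (\<lambda>m. hsum (\<lambda>i. g i m)) = (\<lambda>m. hsum (\<lambda>i. T (g i) m)))"

lemma hlinD:
  assumes "hlin T"
  shows "T (\<lambda>m. f m + g m) = (\<lambda>m. T f m + T g m)"
    and "T (\<lambda>m. r * f m) = (\<lambda>m. r * T f m)"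
    and "T (\<lambda>m. hsum (\<lambda>i. G i m)) = (\<lambda>m. hsum (\<lambda>i. T (G i) m))"
  using assms by (auto simp: hlin_def)

lemma hlin_0: "hlin T \<Longrightarrow> T (\<lambda>m. 0) = (\<lambda>m. 0)"
  using hlinD(2)[of T 0] by simp

lemma hlin_sum:
  assumes "hlin T" "finite K"
  shows "T (\<lambda>m. \<Sum>j\<in>K. F j m) = (\<lambda>m. \<Sum>j\<in>K. T (F j) m)"
  using assms(2) by induction (simp_all add: hlinD[OF assms(1)] hlin_0[OF assms(1)])

lemma hlin_comp: "hlin T \<Longrightarrow> hlin U \<Longrightarrow> hlin (\<lambda>f. T (U f))"
  by (simp add: hlin_def)

lemma hlin_id: "hlin (\<lambda>f. f)"
  by (simp add: hlin_def)

lemma hlin_scale: "hlin (\<lambda>f m. r * f m)"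
  by (simp add: hlin_def hsum_mult algebra_simps)

lemma hlin_lincomb:
  assumes "finite K" "\<And>j. j \<in> K \<Longrightarrow> hlin (T j)"
  shows "hlin (\<lambda>f m. \<Sum>j\<in>K. a j * T j f m)"
proof -
  note T = hlinD[OF assms(2)]
  show ?thesis
    unfolding hlin_def
    by (simp add: T hsum_sum[OF assms(1)] hsum_mult sum.distrib sum_distrib_left distrib_left
        mult.left_commute cong: sum.cong)
qed

section \<open>Extending operators for the letters to the completed free algebra\<close>

definition mon_act :: "('g \<Rightarrow> ('s \<Rightarrow> complex poly fps) \<Rightarrow> 's \<Rightarrow> complex poly fps) \<Rightarrow>
    'g free_mon \<Rightarrow> ('s \<Rightarrow> complex poly fps) \<Rightarrow> 's \<Rightarrow> complex poly fps" where
  "mon_act A w = foldr A (letters w)"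

definition pm_act :: "('g \<Rightarrow> ('s \<Rightarrow> complex poly fps) \<Rightarrow> 's \<Rightarrow> complex poly fps) \<Rightarrow>
    ('g free_mon \<Rightarrow>\<^sub>0 complex) \<Rightarrow> ('s \<Rightarrow> complex poly fps) \<Rightarrow> 's \<Rightarrow> complex poly fps" where
  "pm_act A p f m =
     (\<Sum>w\<in>Poly_Mapping.keys p. fps_const [:Poly_Mapping.lookup p w:] * mon_act A w f m)"

text \<open>The factor \<open>h\<^sup>i\<close> belonging to the \<open>i\<close>-th coefficient of
  \<open>x\<close> is supplied by \<open>hsum\<close>.\<close>

definition fps_act :: "('g \<Rightarrow> ('s \<Rightarrow> complex poly fps) \<Rightarrow> 's \<Rightarrow> complex poly fps) \<Rightarrow>
    ('g free_mon \<Rightarrow>\<^sub>0 complex) fps \<Rightarrow> ('s \<Rightarrow> complex poly fps) \<Rightarrow> 's \<Rightarrow> complex poly fps" where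
  "fps_act A x f m = hsum (\<lambda>i. pm_act A (fps_nth x i) f m)"

lemma pm_act_superset:
  assumes "finite K" "Poly_Mapping.keys p \<subseteq> K"
  shows "pm_act A p f m = (\<Sum>w\<in>K. fps_const [:Poly_Mapping.lookup p w:] * mon_act A w f m)"
  unfolding pm_act_def
  by (rule sum.mono_neutral_left) (use assms in \<open>auto simp: in_keys_iff\<close>)

lemma pm_act_add: "pm_act A (p + q) f m = pm_act A p f m + pm_act A q f m"
proof -
  let ?K = "Poly_Mapping.keys p \<union> Poly_Mapping.keys q"
  have "fps_const [:a + b:] = fps_const [:a:] + fps_const [:b:]" for a b :: complex
    by simp
  then show ?thesis
    using Poly_Mapping.keys_add[of p q]
    by (simp only: pm_act_superset[of ?K] lookup_add distrib_right sum.distrib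
        finite_UnI finite_keys Un_upper1 Un_upper2)
qed

lemma pm_act_zero: "pm_act A 0 f m = 0"
  by (simp add: pm_act_def)

lemma pm_act_sum: "finite K \<Longrightarrow> pm_act A (\<Sum>j\<in>K. p j) f m = (\<Sum>j\<in>K. pm_act A (p j) f m)"
  by (induction K rule: finite_induct) (simp_all add: pm_act_add pm_act_zero)

lemma pm_act_single: "pm_act A (Poly_Mapping.single w c) f m = fps_const [:c:] * mon_act A w f m"
  by (subst pm_act_superset[of "{w}"]) (auto simp: lookup_single)

lemma hlin_mon_act:
  assumes "\<And>g. hlin (A g)"
  shows "hlin (mon_act A w)"
proof -
  have "hlin (foldr A gs)" for gs
    by (induction gs) (simp_all add: hlin_comp assms hlin_id id_def comp_def)
  then show ?thesis by (simp add: mon_act_def)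
qed

lemma hlin_pm_act: "(\<And>g. hlin (A g)) \<Longrightarrow> hlin (pm_act A p)"
  unfolding pm_act_def[abs_def] by (intro hlin_lincomb hlin_mon_act) auto

lemma hlin_fps_act:
  assumes "\<And>g. hlin (A g)"
  shows "hlin (fps_act A x)"
proof -
  note h = hlinD[OF hlin_pm_act[of A, OF assms]]
  have "hsum (\<lambda>i. hsum (\<lambda>j. F i j)) = hsum (\<lambda>j. hsum (\<lambda>i. F i j))" for F :: "nat \<Rightarrow> nat \<Rightarrow> complex poly fps"
    unfolding hsum_hsum by (subst sum_atMost_reverse) (rule refl)
  then show ?thesis
    unfolding hlin_def fps_act_def[abs_def] h by (auto simp: hsum_add hsum_mult)
qed

text \<open>An update at a fresh key is the addition of a single term, so additive claims reduce to
  single words.\<close>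

lemma poly_mapping_add_induct [case_names zero single add]:
  assumes "P 0" "\<And>a b. P (Poly_Mapping.single a b)" "\<And>p q. P p \<Longrightarrow> P q \<Longrightarrow> P (p + q)"
  shows "P (p :: 'a \<Rightarrow>\<^sub>0 'b::monoid_add)"
proof (induction p rule: Poly_Mapping.update_induct)
  case (update f a b)
  have "Poly_Mapping.update a b f = Poly_Mapping.single a b + f"
    using update(1)
    by (intro poly_mapping_eqI) (auto simp: lookup_update lookup_add lookup_single in_keys_iff when_def)
  then show ?case using update assms by metis
qed (rule assms)

lemma mon_act_plus: "mon_act A (v + w) f = mon_act A v (mon_act A w f)"
  by (simp add: mon_act_def plus_free_mon_def)

text \<open>Both sides are additive in \<open>p\<close> and in \<open>q\<close>, which leaves single
  words, where concatenation becomes composition.\<close>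

lemma pm_act_mult:
  assumes A: "\<And>g. hlin (A g)"
  shows "pm_act A (p * q) f = pm_act A p (pm_act A q f)"
proof (induction p rule: poly_mapping_add_induct)
  case (single v c)
  show ?case
  proof (induction q rule: poly_mapping_add_induct)
    case (single w d)
    show ?case
      by (simp add: mult_single pm_act_single[abs_def] mon_act_plus
          hlinD(2)[OF hlin_mon_act[of A, OF A]] mult.assoc[symmetric] mult.commute[of d c])
  next
    case (add p q)
    then show ?case
      by (simp add: distrib_left fun_eq_iff pm_act_add hlinD(1)[OF hlin_pm_act[of A, OF A], symmetric])
  qed (simp add: pm_act_zero[abs_def] fun_eq_iff hlin_0[OF hlin_pm_act[of A, OF A]])
next
  case (add p q)
  then show ?case by (simp add: distrib_right fun_eq_iff pm_act_add)
qed (simp add: fun_eq_iff pm_act_zero)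

lemma fps_act_add: "fps_act A (x + y) f m = fps_act A x f m + fps_act A y f m"
  by (simp add: fps_act_def pm_act_add hsum_add)

lemma fps_act_zero: "fps_act A 0 f m = 0"
  using fps_act_add[of A 0 0 f m] by simp

lemma fps_act_diff: "fps_act A (x - y) f m = fps_act A x f m - fps_act A y f m"
  using fps_act_add[of A "x - y" y f m] by simp

lemma fps_act_sum: "fps_act A (\<Sum>j\<in>K. x j) f m = (\<Sum>j\<in>K. fps_act A (x j) f m)"
  by (induction K rule: infinite_finite_induct) (simp_all add: fps_act_add fps_act_zero)

text \<open>Continuity of \<open>pm_act\<close> moves the inner series outside;
  \<open>hsum_hsum\<close> then produces the coefficients of the product.\<close>

lemma fps_act_mult:
  assumes A: "\<And>g. hlin (A g)"
  shows "fps_act A (x * y) f = fps_act A x (fps_act A y f)"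
proof
  fix m
  have "fps_act A x (fps_act A y f) m
      = hsum (\<lambda>i. hsum (\<lambda>j. pm_act A (fps_nth x i) (pm_act A (fps_nth y j) f) m))"
    unfolding fps_act_def[abs_def] hlinD[OF hlin_pm_act[of A, OF A]] ..
  also have "\<dots> = fps_act A (x * y) f m"
    unfolding hsum_hsum fps_act_def
    by (simp add: fps_mult_nth pm_act_sum pm_act_mult[OF A] atLeast0AtMost)
  finally show "fps_act A (x * y) f m = fps_act A x (fps_act A y f) m" ..
qed

lemma fps_act_const: "fps_act A (fps_const p) f m = pm_act A p f m"
proof -
  \<comment> \<open>Only the term of degree 0 survives; writing this indicator as the coefficients
    of the series 1 makes \<open>hsum_const\<close> applicable.\<close>
  have "fps_act A (fps_const p) f m = hsum (\<lambda>i. fps_const (fps_nth (fps_const 1) i) * pm_act A p f m)"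
    unfolding fps_act_def by (intro arg_cong[of _ _ hsum]) (auto simp: fun_eq_iff pm_act_zero)
  also have "\<dots> = pm_act A p f m"
    using hsum_mult[of "pm_act A p f m" "\<lambda>i. fps_const (fps_nth (fps_const 1) i)"]
    by (simp only: hsum_const) (simp add: mult.commute)
  finally show ?thesis .
qed

lemma fps_act_letter: "fps_act A (letter g) f m = A g f m"
  by (simp add: letter_def fps_act_const pm_act_single mon_act_def pCons_one)

text \<open>The factor on the right is the image of \<open>c\<close> under the inclusion of
  \<open>\<complex>[[h]]\<close> into \<open>\<complex>[C][[h]]\<close>.\<close>

lemma fps_act_scalar:
  "fps_act A (falg_scalar c) f m = Abs_fps (\<lambda>k. [:fps_nth c k:]) * f m"
proof -
  have "fps_act A (falg_scalar c) f m = hsum (\<lambda>i. f m * fps_const (fps_nth (Abs_fps (\<lambda>k. [:fps_nth c k:])) i))"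
    by (simp add: fps_act_def falg_scalar_def pm_act_single mon_act_def zero_free_mon_def mult.commute)
  then show ?thesis
    by (simp only: hsum_mult hsum_const mult.commute)
qed

lemma fps_act_one: "fps_act A 1 f m = f m"
  by (simp add: fps_act_const pm_act_single mon_act_def zero_free_mon_def pCons_one
      del: fps_const_1_eq_1 single_one add: fps_const_1_eq_1[symmetric] single_one[symmetric])

lemma fps_const_sum: "fps_const (\<Sum>j\<in>K. f j) = (\<Sum>j\<in>K. fps_const (f j))"
  by (rule fps_ext) (simp add: fps_sum_nth)

text \<open>Here \<open>[:0, 1:]\<close> is the variable \<open>C\<close>: a word of
  \<open>k\<close> letters \<open>GenC\<close> multiplies by \<open>C\<^sup>k\<close>, and summing
  over the coefficients reassembles \<open>p\<close>.\<close>

lemma fps_act_eval_C: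
  assumes "\<And>f. A GenC f = (\<lambda>m. fps_const [:0, 1:] * f m)"
  shows "fps_act A (eval_C p) f m = p * f m"
proof -
  have rep: "mon_act A (Word (replicate k GenC)) f m = fps_const ([:0, 1:] ^ k) * f m" for k
    by (induction k) (simp_all add: mon_act_def assms mult.assoc[symmetric])
  have "pm_act A (fps_nth (eval_C p) i) f m = f m * fps_const (fps_nth p i)" for i
  proof -
    have "pm_act A (fps_nth (eval_C p) i) f m
        = (\<Sum>k\<le>degree (fps_nth p i). fps_const [:coeff (fps_nth p i) k:] * (fps_const ([:0, 1:] ^ k) * f m))"
      by (simp add: eval_C_def pm_act_sum pm_act_single rep)
    also have "\<dots> = fps_const (\<Sum>k\<le>degree (fps_nth p i). smult (coeff (fps_nth p i) k) ([:0, 1:] ^ k)) * f m"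
      by (simp add: sum_distrib_right mult.assoc[symmetric] fps_const_sum)
    also have "(\<Sum>k\<le>degree (fps_nth p i). smult (coeff (fps_nth p i) k) ([:0, 1:] ^ k)) = fps_nth p i"
      using poly_as_sum_of_monoms[of "fps_nth p i"] by (simp add: monom_altdef)
    finally show ?thesis by (simp add: mult.commute)
  qed
  then show ?thesis
    unfolding fps_act_def by (simp only: hsum_mult hsum_const mult.commute)
qed

lemma fps_act_X_power: "fps_act A (fps_X ^ n * z) f m = fps_X ^ n * fps_act A z f m"
proof -
  have "fps_act A (fps_X ^ n * z) f m = hsum (\<lambda>i. if n \<le> i then pm_act A (fps_nth z (i - n)) f m else 0)"
    unfolding fps_act_def
    by (intro arg_cong[of _ _ hsum]) (auto simp: fun_eq_iff fps_X_power_mult_nth pm_act_zero)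
  then show ?thesis
    by (simp only: hsum_shift[of n "\<lambda>i. pm_act A (fps_nth z i) f m"] fps_act_def)
qed

section \<open>Passing to the ideal and its \<open>h\<close>-adic closure\<close>

text \<open>In \<open>x * a * x'\<close> the middle factor already sends every function to zero, and
  \<open>x\<close> fixes the zero function by linearity.\<close>

lemma fps_act_two_sided_ideal:
  assumes A: "\<And>g. hlin (A g)"
    and "\<And>a f m. a \<in> I \<Longrightarrow> fps_act A a f m = 0"
    and "x \<in> two_sided_ideal I"
  shows "fps_act A x f m = 0"
  using assms(3)
proof induction
  case (step a y x x')
  have "fps_act A a g = (\<lambda>_. 0)" for g using assms(2)[OF step(1)] by blast
  then show ?case
    using step hlin_0[OF hlin_fps_act[of A x, OF A]] by (simp add: fps_act_add fps_act_mult[OF A])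
qed (simp add: fps_act_zero)

lemma fps_X_power_divisible_imp_zero:
  assumes "\<And>n. \<exists>z. x = fps_X ^ n * z"
  shows "x = (0 :: 'a::comm_ring_1 fps)"
proof (rule fps_ext)
  fix k
  obtain z where "x = fps_X ^ Suc k * z" using assms by blast
  then show "fps_nth x k = fps_nth 0 k" by (simp only: fps_X_power_mult_nth) simp
qed

text \<open>Modulo any power of \<open>h\<close> the element agrees with one that acts as zero, so
  its values are divisible by all powers of \<open>h\<close>.\<close>

lemma fps_act_hadic_closure:
  assumes "\<And>x f m. x \<in> I \<Longrightarrow> fps_act A x f m = 0" "x \<in> hadic_closure I"
  shows "fps_act A x f m = 0"
proof (rule fps_X_power_divisible_imp_zero)
  fix n
  obtain y z where "y \<in> I" "x - y = fps_X ^ n * z"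
    using assms(2) unfolding hadic_closure_def by blast
  then have "fps_act A x f m = fps_X ^ n * fps_act A z f m"
    using assms(1)[of y f m] fps_act_diff[of A x y f m] by (simp add: fps_act_X_power)
  then show "\<exists>z. fps_act A x f m = fps_X ^ n * z" ..
qed


section \<open>The transposed Fock representation\<close>

text \<open>As a class instance, the order of the generators is the one that \<open>sorted\<close>,
  \<open>sort\<close> and the comparison in \<open>wick\<close> refer to.\<close>

instantiation hat_gen :: (linorder) linorder
begin

definition "a \<le> b \<longleftrightarrow> hat_le a b"
definition "a < b \<longleftrightarrow> hat_le a b \<and> \<not> hat_le b a" for a b :: "'a hat_gen"

instance
proof
  fix x y z :: "'a hat_gen"
  show "x < y \<longleftrightarrow> x \<le> y \<and> \<not> y \<le> x"
    by (simp add: less_eq_hat_gen_def less_hat_gen_def)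
  show "x \<le> x"
    by (cases x) (simp_all add: less_eq_hat_gen_def)
  show "x \<le> y \<Longrightarrow> y \<le> z \<Longrightarrow> x \<le> z"
    by (cases x; cases y; cases z) (auto simp: less_eq_hat_gen_def)
  show "x \<le> y \<Longrightarrow> y \<le> x \<Longrightarrow> x = y"
    by (cases x; cases y) (auto simp: less_eq_hat_gen_def)
  show "x \<le> y \<or> y \<le> x"
    by (cases x; cases y) (auto simp: less_eq_hat_gen_def)
qed

end

lemma increasing_words_altdef: "increasing_words = {ms. set ms \<subseteq> hat_gens \<and> sorted ms}"
  by (simp add: increasing_words_def less_eq_hat_gen_def[abs_def])

lemma HatC_le: "HatC \<le> a"
  by (simp add: less_eq_hat_gen_def)

section \<open>Wick operators and their commutators\<close>

text \<open>Read \<open>f m\<close> as the value of a functional on the increasing monomial with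
  content \<open>m\<close>. The formula is its value on that monomial times \<open>a\<close> on the
  right: moving \<open>a\<close> left past a larger \<open>c\<close> costs
  \<open>- \<omega> a c\<close>. As the sum runs over a multiset, repeated letters count with
  multiplicity.\<close>

definition wick :: "('a::linorder \<Rightarrow> 'a \<Rightarrow> 'r::comm_ring_1 fps) \<Rightarrow> 'a \<Rightarrow>
    ('a multiset \<Rightarrow> 'r fps) \<Rightarrow> 'a multiset \<Rightarrow> 'r fps" where
  "wick \<omega> a f m =
     f (add_mset a m) - (\<Sum>c\<in>#m. (if a < c then \<omega> a c else 0) * f (m - {#c#}))"

text \<open>Both sides run over ordered pairs of distinct occurrences in \<open>m\<close>; the
  induction splits off the pairs that involve the new element.\<close>

lemma sum_mset_diff_single_swap:
  "(\<Sum>c\<in>#m. \<Sum>d\<in>#m - {#c#}. G c d) = (\<Sum>c\<in>#m. \<Sum>d\<in>#m - {#c#}. G d c)"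
  for G :: "'a \<Rightarrow> 'a \<Rightarrow> 'b::comm_monoid_add"
proof (induction m)
  case (add x m)
  have *: "(\<Sum>c\<in>#add_mset x m. \<Sum>d\<in>#add_mset x m - {#c#}. G c d) =
      (\<Sum>d\<in>#m. G x d) + (\<Sum>c\<in>#m. G c x + (\<Sum>d\<in>#m - {#c#}. G c d))" for G :: "'a \<Rightarrow> 'a \<Rightarrow> 'b"
  proof -
    have "(\<Sum>c\<in>#m. \<Sum>d\<in>#add_mset x m - {#c#}. G c d) = (\<Sum>c\<in>#m. G c x + (\<Sum>d\<in>#m - {#c#}. G c d))"
      by (intro arg_cong[of _ _ sum_mset] image_mset_cong) (simp add: add_mset_commute)
    then show ?thesis by simp
  qed
  show ?case
    unfolding * *[of "\<lambda>c d. G d c"] using add by (simp add: sum_mset.distrib ac_simps)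
qed simp

lemma sum_mset_subtractf:
  "(\<Sum>c\<in>#m. F c - G c) = (\<Sum>c\<in>#m. F c) - (\<Sum>c\<in>#m. G c)" for F :: "'a \<Rightarrow> 'b::ab_group_add"
  by (induction m) simp_all

text \<open>Only the contractions of \<open>a\<close> and \<open>b\<close> with each other survive
  in the difference. They give \<open>L a b - L b a\<close>, where at most one term can be nonzero,
  and antisymmetry turns either into \<open>\<omega> a b\<close>.\<close>

lemma wick_wick:
  assumes "\<And>a b. \<omega> a b = - \<omega> b a"
  shows "wick \<omega> a (wick \<omega> b f) m - wick \<omega> b (wick \<omega> a f) m = (if a = b then 0 else \<omega> a b * f m)"
proof -
  \<comment> \<open>\<open>L\<close> is the factor of a contraction. In \<open>S a b\<close> a
    letter of \<open>m\<close> is contracted with \<open>a\<close> while \<open>b\<close> is added;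
    in \<open>D a b\<close> two occurrences are contracted, one with each.\<close>
  define L where "L a c = (if a < c then \<omega> a c else 0)" for a c
  define S where "S a b = (\<Sum>c\<in>#m. L a c * f (add_mset b (m - {#c#})))" for a b
  define D where "D a b = (\<Sum>c\<in>#m. \<Sum>d\<in>#m - {#c#}. L a c * (L b d * f (m - {#c#} - {#d#})))" for a b
  have *: "wick \<omega> a (wick \<omega> b f) m = f (add_mset a (add_mset b m)) - L b a * f m - S b a - S a b + D a b" for a b
  proof -
    have "(\<Sum>d\<in>#m. L b d * f (add_mset a m - {#d#})) = S b a"
      unfolding S_def by (intro arg_cong[of _ _ sum_mset] image_mset_cong) simp
    \<comment> \<open>The term \<open>L b a * f m\<close> comes from contracting \<open>b\<close>
      with the letter \<open>a\<close> just added.\<close>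
    then have 1: "wick \<omega> b f (add_mset a m) = f (add_mset a (add_mset b m)) - (L b a * f m + S b a)"
      unfolding wick_def L_def[symmetric] by (simp add: add_mset_commute)
    have 2: "(\<Sum>c\<in>#m. L a c * wick \<omega> b f (m - {#c#})) = S a b - D a b"
      unfolding S_def D_def wick_def L_def[symmetric]
      by (simp add: right_diff_distrib sum_mset_distrib_left sum_mset_subtractf)
    show ?thesis
      using 1 2 by (simp add: wick_def[of \<omega> a] L_def[symmetric])
  qed
  have "D a b = D b a"
    unfolding D_def
    by (subst sum_mset_diff_single_swap)
       (simp add: mult.left_commute add_mset_commute)
  then have "wick \<omega> a (wick \<omega> b f) m - wick \<omega> b (wick \<omega> a f) m = (L a b - L b a) * f m"
    unfolding * by (simp add: algebra_simps add_mset_commute)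
  also have "\<dots> = (if a = b then 0 else \<omega> a b * f m)"
    using assms[of a b] by (auto simp: L_def)
  finally show ?thesis .
qed

lemma hsum_sum_mset: "hsum (\<lambda>i. \<Sum>c\<in>#M. F c i) = (\<Sum>c\<in>#M. hsum (F c))"
proof (induction M)
  case empty
  then show ?case by (simp add: hsum_def fps_eq_iff)
qed (simp add: hsum_add)

lemma hlin_wick: "hlin (wick \<omega> a)"
proof -
  have diff: "hsum (\<lambda>i. F i - G i) = hsum F - hsum G" for F G :: "nat \<Rightarrow> 'b::comm_ring_1 fps"
    using hsum_add[of "\<lambda>i. F i - G i" G] by simp
  show ?thesis
    unfolding hlin_def wick_def[abs_def]
    by (simp add: diff hsum_sum_mset hsum_mult fun_eq_iff distrib_left sum_mset.distrib
        right_diff_distrib sum_mset_distrib_left mult.left_commute)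
qed

fun hat_op :: "('n::linorder hat_gen \<Rightarrow> 'n hat_gen \<Rightarrow> complex poly fps) \<Rightarrow> 'n hat_gen \<Rightarrow>
    ('n hat_gen multiset \<Rightarrow> complex poly fps) \<Rightarrow> 'n hat_gen multiset \<Rightarrow> complex poly fps" where
  "hat_op \<omega> HatC = (\<lambda>f m. fps_const [:0, 1:] * f m)"
| "hat_op \<omega> (HatY j r) = wick \<omega> (HatY j r)"

text \<open>Applying the largest letter of an increasing word first, no contraction ever occurs.\<close>

lemma foldr_hat_op_sorted:
  assumes "sorted w" "\<And>a c. a \<in> set w \<Longrightarrow> a \<noteq> HatC \<Longrightarrow> c \<in># m \<Longrightarrow> c \<le> a"
  shows "foldr (hat_op \<omega>) w f m =
    fps_const ([:0, 1:] ^ count (mset w) HatC) * f (m + filter_mset (\<lambda>a. a \<noteq> HatC) (mset w))"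
  using assms
\<comment> \<open>A letter other than \<open>HatC\<close> moves from the word into \<open>m\<close>,
  which therefore holds letters not above those still to come.\<close>
proof (induction w arbitrary: m)
  case (Cons a w)
  show ?case
  proof (cases a)
    case HatC
    have "foldr (hat_op \<omega>) w f m =
      fps_const ([:0, 1:] ^ count (mset w) HatC) * f (m + filter_mset (\<lambda>a. a \<noteq> HatC) (mset w))"
      using Cons.prems by (intro Cons.IH) auto
    with HatC show ?thesis by (simp add: mult.assoc[symmetric])
  next
    case (HatY j r)
    have "(\<Sum>c\<in>#m. (if HatY j r < c then \<omega> (HatY j r) c else 0) * g (m - {#c#})) = (\<Sum>c\<in>#m. 0)" for g
      using Cons.prems HatY
      by (intro arg_cong[of _ _ sum_mset] image_mset_cong) (auto simp: leD)
    moreover have "foldr (hat_op \<omega>) w f (add_mset a m) =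
      fps_const ([:0, 1:] ^ count (mset w) HatC) * f (add_mset a m + filter_mset (\<lambda>a. a \<noteq> HatC) (mset w))"
      using Cons.prems HatY by (intro Cons.IH) auto
    ultimately show ?thesis using HatY by (simp add: wick_def)
  qed
qed simp

section \<open>The coefficients of \<open>S\<close> and the brackets they prescribe\<close>

text \<open>The variables \<open>h\<close> and \<open>u\<close> enter \<open>T_mat\<close> only
  through \<open>h/u\<close>, so after division by \<open>h\<^sup>2\<close> the power
  \<open>h\<^sup>k\<close> carries only the power \<open>-k-2\<close> of \<open>u\<close>.\<close>

lemma s_coeff_nth:
  "fps_nth (s_coeff i j r s) k =
     smult (diff_pow_coeff (k + 2) r s) (fps_nth (T_mat $ (i, j) $ (i, j)) (k + 2))"
proof -
  let ?t = "fps_nth (T_mat $ (i, j) $ (i, j)) (k + 2)"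
  have "fps_nth (s_series i j) k = monom ?t (k + 2)"
    by (simp add: s_series_def subst_h_over_u_def)
  then have "fps_nth (s_coeff i j r s) k =
      (\<Sum>p\<le>degree (monom ?t (k + 2)). smult (diff_pow_coeff p r s) (coeff (monom ?t (k + 2)) p))"
    by (simp add: s_coeff_def)
  also have "\<dots> = (\<Sum>p\<le>k + 2. if p = k + 2 then smult (diff_pow_coeff p r s) ?t else 0)"
    by (cases "?t = 0") (auto simp: degree_monom_eq intro!: sum.cong)
  finally show ?thesis by simp
qed

text \<open>A diagonal entry of \<open>T_mat\<close> at \<open>(i, j)\<close> depends on the indices
  only through whether \<open>i = j\<close>.\<close>

lemma s_coeff_commute: "s_coeff i j r s = s_coeff j i r s"
  by (rule fps_ext) (simp add: s_coeff_nth T_mat_def mat_mult_nth RR_mat_nth mat_1_nth eq_commute)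

lemma sum_smult: "(\<Sum>i\<in>K. smult a (p i)) = smult a (\<Sum>i\<in>K. p i)"
  by (induction K rule: infinite_finite_induct) (simp_all add: smult_add_right)

text \<open>This is the vanishing of the first partial trace, part of the condition that defines
  \<open>G_series\<close>, read off on the diagonal.\<close>

lemma sum_s_coeff: "(\<Sum>i\<in>UNIV. s_coeff i j r s) = 0"
proof -
  have "ptrace1 (T_mat :: 'a tmat) $ j $ j = 0"
    using is_G_G_series[where 'n='a] by (simp add: is_G_def T_mat_def)
  then have "fps_nth (\<Sum>i\<in>UNIV. (T_mat :: 'a tmat) $ (i, j) $ (i, j)) k = 0" for k
    by (simp add: ptrace1_def)
  then show ?thesis
    by (intro fps_ext) (simp add: fps_sum_nth s_coeff_nth sum_smult)
qed

text \<open>The commutator of \<open>hc_y i r\<close> with \<open>hc_y j s\<close> that the relation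
  \<open>exchange\<close> forces.\<close>

definition y_bracket :: "'n::finite \<Rightarrow> int \<Rightarrow> 'n \<Rightarrow> int \<Rightarrow> complex poly fps" where
  "y_bracket i r j s = s_coeff i j s r - s_coeff i j r s"

lemma y_bracket_antisym: "y_bracket i r j s = - y_bracket j s i r"
  by (simp add: y_bracket_def s_coeff_commute[of i])

lemma sum_y_bracket_left: "(\<Sum>i\<in>UNIV. y_bracket i r j s) = 0"
  by (simp add: y_bracket_def sum_subtractf sum_s_coeff)

lemma sum_y_bracket_right: "(\<Sum>j\<in>UNIV. y_bracket i r j s) = 0"
  by (simp add: y_bracket_antisym[of i] sum_negf sum_y_bracket_left)

section \<open>Linear algebra between the original and the hatted generators\<close>

text \<open>The \<open>\<mu> i j\<close> are the coordinates of \<open>cartan_a i\<close> in the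
  hatted basis. As \<open>cartan\<close> is a quotient by constant vectors, the expansion lifts to
  coordinate vectors only up to a constant vector, whose entries are
  \<open>\<kappa> i\<close>.\<close>

locale hat_coeffs =
  fixes \<nu> \<mu> :: "'n::{finite,linorder} \<Rightarrow> 'n \<Rightarrow> complex" and \<kappa> :: "'n \<Rightarrow> complex"
  assumes sum_\<mu>: "j \<in> low_indices \<Longrightarrow> (\<Sum>i\<in>UNIV. \<mu> i j) = 0"
    and \<nu>_\<mu>: "j \<in> low_indices \<Longrightarrow> k \<in> low_indices \<Longrightarrow>
      (\<Sum>i\<in>{..j}. \<nu> i j * \<mu> i k) = (if j = k then 1 else 0)"
    and \<mu>_\<nu>: "(\<Sum>j\<in>low_indices. if l \<le> j then \<mu> i j * \<nu> l j else 0) = (if i = l then 1 else 0) - \<kappa> i"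

lemma cartan_abs_sum:
  "(\<Sum>j\<in>K. cartan_scale (a j) (abs_cartan (v j))) = abs_cartan (\<Sum>j\<in>K. a j *s v j)"
  by (induction K rule: infinite_finite_induct)
     (simp_all add: zero_cartan_def plus_cartan.abs_eq cartan_scale.abs_eq)

lemma sum_cartan_a: "(\<Sum>i\<in>UNIV. cartan_a i) = (0 :: 'n::finite cartan)"
proof -
  have "(\<Sum>i\<in>UNIV. cartan_a i) = (\<Sum>i\<in>UNIV. cartan_scale 1 (abs_cartan (axis i 1 :: complex ^ 'n)))"
    by (simp add: cartan_a_def)
  also have "\<dots> = abs_cartan (\<Sum>i\<in>UNIV. 1 *s axis i 1)"
    by (rule cartan_abs_sum)
  also have "(\<Sum>i\<in>UNIV. 1 *s axis i 1) = (\<chi> i. (1 :: complex))"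
    by (simp add: vec_eq_iff axis_def if_distrib cong: if_cong)
  also have "abs_cartan (\<chi> i. (1 :: complex)) = abs_cartan (0 :: complex ^ 'n)"
    unfolding cartan.abs_eq_iff by (rule exI[of _ 1]) (simp add: vec_eq_iff)
  finally show ?thesis by (simp add: zero_cartan_def)
qed

text \<open>Expanding each \<open>cartan_a i\<close> in the basis gives \<open>\<mu>\<close>.
  Independence yields the first two identities by comparing coefficients, in the sum of all
  \<open>cartan_a i\<close> and in the basis vectors themselves; the third comes from lifting to
  coordinate vectors.\<close>

lemma orthonormal_basis_coeffs_imp_hat_coeffs:
  fixes \<nu> :: "'n::{finite,linorder} \<Rightarrow> 'n \<Rightarrow> complex"
  assumes "orthonormal_basis_coeffs \<nu>"
  obtains \<mu> \<kappa> where "hat_coeffs \<nu> \<mu> \<kappa>"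
proof -
  note basis = assms[unfolded orthonormal_basis_coeffs_def]
  have indep: "t k = 0" if "(\<Sum>j\<in>low_indices. cartan_scale (t j) (cartan_hat \<nu> j)) = 0" "k \<in> low_indices" for t k
  proof -
    have inj: "inj_on (cartan_hat \<nu>) low_indices" using basis by blast
    \<comment> \<open>Independence concerns the set of vectors; injectivity turns coefficients
      indexed by \<open>j\<close> into a function on that set.\<close>
    define u where "u v = t (the_inv_into low_indices (cartan_hat \<nu>) v)" for v
    have u: "u (cartan_hat \<nu> j) = t j" if "j \<in> low_indices" for j
      using that inj by (simp add: u_def the_inv_into_f_f)
    have "(\<Sum>v\<in>cartan_hat \<nu> ` low_indices. cartan_scale (u v) v) = 0"
      using that(1) by (simp add: sum.reindex[OF inj] u cong: sum.cong)
    then have "u (cartan_hat \<nu> k) = 0"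
      using basis that(2) by (intro cartan.independentD[of "cartan_hat \<nu> ` low_indices"]) auto
    then show ?thesis using u that(2) by simp
  qed
  have "\<exists>m. cartan_a i = (\<Sum>j\<in>low_indices. cartan_scale (m j) (cartan_hat \<nu> j))" for i
  proof -
    have "cartan_a i \<in> cartan.span (cartan_hat \<nu> ` low_indices)"
      using basis by simp
    then obtain u where "cartan_a i = (\<Sum>v\<in>cartan_hat \<nu> ` low_indices. cartan_scale (u v) v)"
      by (auto simp: cartan.span_finite)
    then show ?thesis
      using basis by (auto simp: sum.reindex)
  qed
  then obtain \<mu> where \<mu>: "\<And>i. cartan_a i = (\<Sum>j\<in>low_indices. cartan_scale (\<mu> i j) (cartan_hat \<nu> j))"
    by metis
  \<comment> \<open>A representative of \<open>cartan_hat \<nu> j\<close>, cut off above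
    \<open>j\<close> where the defining sum stops.\<close>
  define vec where "vec j = (\<chi> l. if l \<le> j then \<nu> l j else 0)" for j
  have hat: "cartan_hat \<nu> j = abs_cartan (vec j)" for j
  proof -
    have "cartan_hat \<nu> j = abs_cartan (\<Sum>i\<in>{..j}. \<nu> i j *s axis i 1)"
      unfolding cartan_hat_def cartan_a_def by (simp add: cartan_abs_sum)
    also have "(\<Sum>i\<in>{..j}. \<nu> i j *s axis i 1) = vec j"
      by (auto simp: vec_def vec_eq_iff axis_def if_distrib cong: if_cong)
    finally show ?thesis .
  qed
  have "\<exists>c. axis i 1 - (\<Sum>j\<in>low_indices. \<mu> i j *s vec j) = (\<chi> l. c)" for i
  proof -
    have "abs_cartan (axis i 1) = abs_cartan (\<Sum>j\<in>low_indices. \<mu> i j *s vec j)"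
      using \<mu>[of i] by (simp add: hat cartan_abs_sum cartan_a_def)
    then show ?thesis by (simp add: cartan.abs_eq_iff)
  qed
  then obtain \<kappa> where \<kappa>: "\<And>i. axis i 1 - (\<Sum>j\<in>low_indices. \<mu> i j *s vec j) = (\<chi> l. \<kappa> i)"
    by metis
  have "hat_coeffs \<nu> \<mu> \<kappa>"
  proof
    fix k :: 'n assume k: "k \<in> low_indices"
    have "(\<Sum>j\<in>low_indices. cartan_scale (\<Sum>i\<in>UNIV. \<mu> i j) (cartan_hat \<nu> j)) = (\<Sum>i\<in>UNIV. cartan_a i)"
      unfolding \<mu> cartan.scale_sum_left by (rule sum.swap)
    then show "(\<Sum>i\<in>UNIV. \<mu> i k) = 0"
      using indep[OF _ k] by (simp add: sum_cartan_a)
  next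
    fix j k :: 'n assume jk: "j \<in> low_indices" "k \<in> low_indices"
    have "(\<Sum>k\<in>low_indices. cartan_scale ((\<Sum>i\<in>{..j}. \<nu> i j * \<mu> i k)) (cartan_hat \<nu> k))
        = (\<Sum>i\<in>{..j}. cartan_scale (\<nu> i j) (cartan_a i))"
      unfolding \<mu> cartan.scale_sum_left cartan.scale_sum_right cartan.scale_scale by (rule sum.swap)
    also have "\<dots> = (\<Sum>k\<in>low_indices. if k = j then cartan_hat \<nu> k else 0)"
      using jk by (simp add: cartan_hat_def)
    also have "\<dots> = (\<Sum>k\<in>low_indices. cartan_scale (if j = k then 1 else 0) (cartan_hat \<nu> k))"
      by (intro sum.cong) auto
    finally have "(\<Sum>k\<in>low_indices. cartan_scale ((\<Sum>i\<in>{..j}. \<nu> i j * \<mu> i k) - (if j = k then 1 else 0)) (cartan_hat \<nu> k)) = 0"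
      by (simp add: cartan.scale_left_diff_distrib sum_subtractf)
    then show "(\<Sum>i\<in>{..j}. \<nu> i j * \<mu> i k) = (if j = k then 1 else 0)"
      using indep[OF _ jk(2)] by fastforce
  next
    fix l i :: 'n
    have "(\<Sum>j\<in>low_indices. if l \<le> j then \<mu> i j * \<nu> l j else 0) = (\<Sum>j\<in>low_indices. \<mu> i j *s vec j) $ l"
      by (auto simp: vec_def intro!: sum.cong)
    also have "\<dots> = (axis i 1 - (axis i 1 - (\<Sum>j\<in>low_indices. \<mu> i j *s vec j))) $ l"
      by simp
    also have "\<dots> = (if i = l then 1 else 0) - \<kappa> i"
      unfolding \<kappa> by (simp add: axis_def)
    finally show "(\<Sum>j\<in>low_indices. if l \<le> j then \<mu> i j * \<nu> l j else 0) = (if i = l then 1 else 0) - \<kappa> i" .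
  qed
  then show ?thesis by (rule that)
qed

text \<open>The bilinear extension of \<open>y_bracket\<close> to the hatted generators, with
  \<open>C\<close> central.\<close>

fun hat_bracket :: "('n::{finite,linorder} \<Rightarrow> 'n \<Rightarrow> complex) \<Rightarrow> 'n hat_gen \<Rightarrow> 'n hat_gen \<Rightarrow> complex poly fps" where
  "hat_bracket \<nu> (HatY j r) (HatY k s) =
     (\<Sum>i\<in>{..j}. fps_const [:\<nu> i j:] * (\<Sum>l\<in>{..k}. fps_const [:\<nu> l k:] * y_bracket i r l s))"
| "hat_bracket \<nu> _ _ = 0"

lemma hat_bracket_antisym: "hat_bracket \<nu> a b = - hat_bracket \<nu> b a"
proof (cases "\<exists>j r k s. a = HatY j r \<and> b = HatY k s")
  case True
  then obtain j r k s where ab: "a = HatY j r" "b = HatY k s" by blast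
  have "hat_bracket \<nu> a b =
      (\<Sum>l\<in>{..k}. \<Sum>i\<in>{..j}. fps_const [:\<nu> i j:] * (fps_const [:\<nu> l k:] * y_bracket i r l s))"
    unfolding ab hat_bracket.simps sum_distrib_left by (rule sum.swap)
  also have "\<dots> = (\<Sum>l\<in>{..k}. \<Sum>i\<in>{..j}. - (fps_const [:\<nu> l k:] * (fps_const [:\<nu> i j:] * y_bracket l s i r)))"
    by (simp add: y_bracket_antisym[of _ r _ s] mult.left_commute del: fps_const_mult)
  finally show ?thesis
    by (simp add: ab sum_negf sum_distrib_left)
next
  case False
  then show ?thesis by (cases a; cases b) auto
qed

text \<open>Antisymmetry makes twice the bracket zero. Hence the value 0 that
  \<open>wick_wick\<close> gives for \<open>a = b\<close> is also the bracket.\<close>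

lemma hat_bracket_self: "hat_bracket \<nu> a a = 0"
proof (rule fps_ext)
  fix k
  have "hat_bracket \<nu> a a + hat_bracket \<nu> a a = 0"
    by (subst (2) hat_bracket_antisym) simp
  then have "2 * fps_nth (hat_bracket \<nu> a a) k = 0"
    unfolding mult_2 fps_add_nth[symmetric] by simp
  then show "fps_nth (hat_bracket \<nu> a a) k = fps_nth 0 k" by simp
qed

text \<open>The change of basis is needed in two complex modules: the values of the functions acted
  upon, and the algebra itself.\<close>

lemma module_poly_fps: "module (\<lambda>a (x :: complex poly fps). fps_const [:a:] * x)"
proof
  fix a b :: complex and x y :: "complex poly fps"
  have "fps_const [:a + b:] = fps_const [:a:] + fps_const [:b:]" by simp
  then show "fps_const [:a + b:] * x = fps_const [:a:] * x + fps_const [:b:] * x"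
    by (simp only: distrib_right)
qed (simp_all add: distrib_left mult.assoc[symmetric] mult.commute[of b a] pCons_one)

lemma module_hc: "module (\<lambda>a (x :: 'n::finite hc). hc_scale (fps_const a) x)"
proof
  fix a b :: complex and x y :: "'n hc"
  show "hc_scale (fps_const (a + b)) x = hc_scale (fps_const a) x + hc_scale (fps_const b) x"
    using hc.scale_left_distrib[of "fps_const a" "fps_const b" x] by simp
qed (simp_all add: hc.scale_right_distrib)

context hat_coeffs
begin

text \<open>By \<open>\<mu>_\<nu>\<close> the round trip changes \<open>B i\<close> only by
  \<open>\<kappa> i\<close> times the sum of all \<open>B l\<close>, which is zero.\<close>

lemma hat_change_of_basis:
  assumes "module sc" "(\<Sum>l\<in>UNIV. B l) = 0"
  shows "(\<Sum>j\<in>low_indices. sc (\<mu> i j) (\<Sum>l\<in>{..j}. sc (\<nu> l j) (B l))) = B i"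
proof -
  interpret module sc by fact
  have "(\<Sum>l\<in>{..j}. sc (\<nu> l j) (B l)) = (\<Sum>l\<in>UNIV. sc (if l \<le> j then \<nu> l j else 0) (B l))" for j
    by (rule sum.mono_neutral_cong_left) auto
  then have "(\<Sum>j\<in>low_indices. sc (\<mu> i j) (\<Sum>l\<in>{..j}. sc (\<nu> l j) (B l)))
      = (\<Sum>j\<in>low_indices. \<Sum>l\<in>UNIV. sc (if l \<le> j then \<mu> i j * \<nu> l j else 0) (B l))"
    by (auto simp: scale_sum_right intro!: sum.cong)
  also have "\<dots> = (\<Sum>l\<in>UNIV. sc ((if i = l then 1 else 0) - \<kappa> i) (B l))"
    by (subst sum.swap) (simp only: scale_sum_left[symmetric] \<mu>_\<nu>)
  also have "\<dots> = (\<Sum>l\<in>UNIV. if i = l then B l else 0) - sc (\<kappa> i) (\<Sum>l\<in>UNIV. B l)"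
    by (auto simp: scale_left_diff_distrib sum_subtractf scale_sum_right if_distrib[of "\<lambda>a. sc a _"] cong: if_cong)
  finally show ?thesis using assms(2) by simp
qed

lemma hat_change_of_basis_inverse:
  assumes "module sc" "j \<in> low_indices"
  shows "(\<Sum>i\<in>{..j}. sc (\<nu> i j) (\<Sum>k\<in>low_indices. sc (\<mu> i k) (B k))) = B j"
proof -
  interpret module sc by fact
  have "(\<Sum>i\<in>{..j}. sc (\<nu> i j) (\<Sum>k\<in>low_indices. sc (\<mu> i k) (B k)))
      = (\<Sum>k\<in>low_indices. sc (\<Sum>i\<in>{..j}. \<nu> i j * \<mu> i k) (B k))"
    by (simp add: scale_sum_right scale_sum_left) (rule sum.swap)
  also have "\<dots> = (\<Sum>k\<in>low_indices. if j = k then B k else 0)"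
    using assms(2) by (intro sum.cong) (auto simp: \<nu>_\<mu>)
  finally show ?thesis using assms(2) by simp
qed

section \<open>The representation of the generators and of the quotient algebra\<close>

fun gen_op :: "'n gen \<Rightarrow> ('n hat_gen multiset \<Rightarrow> complex poly fps) \<Rightarrow> 'n hat_gen multiset \<Rightarrow> complex poly fps" where
  "gen_op GenC = (\<lambda>f m. fps_const [:0, 1:] * f m)"
| "gen_op (GenY i r) = (\<lambda>f m. \<Sum>j\<in>low_indices. fps_const [:\<mu> i j:] * wick (hat_bracket \<nu>) (HatY j r) f m)"

lemma hlin_gen_op: "hlin (gen_op g)"
  by (cases g) (simp_all add: hlin_scale hlin_lincomb hlin_wick)

text \<open>Bilinearity reduces this to \<open>wick_wick\<close>; the double sum of hatted brackets
  collapses to \<open>y_bracket\<close> by one change of basis in each argument.\<close>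

lemma gen_op_commutator:
  "gen_op (GenY i r) (gen_op (GenY k s) f) m - gen_op (GenY k s) (gen_op (GenY i r) f) m = y_bracket i r k s * f m"
proof -
  let ?w = "\<lambda>j r. wick (hat_bracket \<nu>) (HatY j r)"
  have *: "gen_op (GenY i r) (gen_op (GenY k s) f) m =
      (\<Sum>j\<in>low_indices. \<Sum>l\<in>low_indices. fps_const [:\<mu> i j:] * (fps_const [:\<mu> k l:] * ?w j r (?w l s f) m))"
    for i r k s
    by (simp add: hlin_sum[OF hlin_wick] hlinD(2)[OF hlin_wick] sum_distrib_left del: fps_const_mult)
  have "gen_op (GenY i r) (gen_op (GenY k s) f) m - gen_op (GenY k s) (gen_op (GenY i r) f) m =
      (\<Sum>j\<in>low_indices. \<Sum>l\<in>low_indices. fps_const [:\<mu> i j:] * (fps_const [:\<mu> k l:] * ?w j r (?w l s f) m))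
      - (\<Sum>j\<in>low_indices. \<Sum>l\<in>low_indices. fps_const [:\<mu> k l:] * (fps_const [:\<mu> i j:] * ?w l s (?w j r f) m))"
    unfolding * by (subst (2) sum.swap) (rule refl)
  also have "\<dots> = (\<Sum>j\<in>low_indices. \<Sum>l\<in>low_indices. fps_const [:\<mu> i j:] * (fps_const [:\<mu> k l:] *
      (?w j r (?w l s f) m - ?w l s (?w j r f) m)))"
    by (simp add: sum_subtractf right_diff_distrib mult.left_commute del: fps_const_mult)
  also have "\<dots> = (\<Sum>j\<in>low_indices. \<Sum>l\<in>low_indices. fps_const [:\<mu> i j:] * (fps_const [:\<mu> k l:] *
      hat_bracket \<nu> (HatY j r) (HatY l s))) * f m"
    by (simp only: wick_wick[of "hat_bracket \<nu>", OF hat_bracket_antisym] sum_distrib_right)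
       (intro sum.cong refl, auto simp: hat_bracket_self mult.assoc simp del: hat_bracket.simps)
  \<comment> \<open>The sums are nested so that \<open>hat_change_of_basis\<close> applies to the
    second argument inside and to the first argument outside.\<close>
  also have "(\<Sum>j\<in>low_indices. \<Sum>l\<in>low_indices. fps_const [:\<mu> i j:] * (fps_const [:\<mu> k l:] *
      hat_bracket \<nu> (HatY j r) (HatY l s))) = (\<Sum>j\<in>low_indices. fps_const [:\<mu> i j:] *
        (\<Sum>i\<in>{..j}. fps_const [:\<nu> i j:] * (\<Sum>l\<in>low_indices. fps_const [:\<mu> k l:] *
          (\<Sum>l'\<in>{..l}. fps_const [:\<nu> l' l:] * y_bracket i r l' s))))"
  proof (intro sum.cong refl)
    fix j
    have "(\<Sum>l\<in>low_indices. fps_const [:\<mu> k l:] * (\<Sum>i\<in>{..j}. fps_const [:\<nu> i j:] * X i l)) =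
      (\<Sum>i\<in>{..j}. fps_const [:\<nu> i j:] * (\<Sum>l\<in>low_indices. fps_const [:\<mu> k l:] * X i l))" for X
      unfolding sum_distrib_left by (subst sum.swap) (simp only: mult.left_commute)
    then show "(\<Sum>l\<in>low_indices. fps_const [:\<mu> i j:] * (fps_const [:\<mu> k l:] *
      hat_bracket \<nu> (HatY j r) (HatY l s))) = fps_const [:\<mu> i j:] *
        (\<Sum>i\<in>{..j}. fps_const [:\<nu> i j:] * (\<Sum>l\<in>low_indices. fps_const [:\<mu> k l:] *
          (\<Sum>l'\<in>{..l}. fps_const [:\<nu> l' l:] * y_bracket i r l' s)))"
      by (simp only: sum_distrib_left[symmetric] hat_bracket.simps)
  qed
  also have "\<dots> = y_bracket i r k s"
    using hat_change_of_basis[OF module_poly_fps]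
    by (simp only: sum_y_bracket_left sum_y_bracket_right)
  finally show ?thesis .
qed

text \<open>Multiplication by \<open>C\<close> commutes with every linear operator, the exchange
  relation is \<open>gen_op_commutator\<close>, and the sum relation follows from
  \<open>sum_\<mu>\<close>.\<close>

lemma gen_op_relator:
  assumes "a \<in> relators"
  shows "fps_act gen_op a f m = 0"
  using assms
proof cases
  case (central x)
  have "fps_act gen_op (letter GenC) g = (\<lambda>m. fps_const [:0, 1:] * g m)" for g
    by (rule ext) (simp add: fps_act_letter)
  then show ?thesis
    by (simp only: central fps_act_diff fps_act_mult[of gen_op, OF hlin_gen_op]
        hlinD(2)[OF hlin_fps_act[of gen_op, OF hlin_gen_op]]) simp
next
  case (exchange i r j s)
  have "fps_act gen_op (letter g) = gen_op g" for g
    by (intro ext) (rule fps_act_letter)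
  then show ?thesis
    using gen_op_commutator[of i r j s f m]
    by (simp only: exchange fps_act_diff fps_act_add fps_act_mult[of gen_op, OF hlin_gen_op]
        fps_act_eval_C[of gen_op, OF gen_op.simps(1)[THEN fun_cong]] y_bracket_def)
       (simp add: algebra_simps del: gen_op.simps)
next
  case (sum_zero r)
  let ?w = "\<lambda>j. wick (hat_bracket \<nu>) (HatY j r) f m"
  have c: "fps_const [:\<Sum>i\<in>K. h i:] = (\<Sum>i\<in>K. fps_const [:h i:])" for K :: "'n set" and h
  proof (induction K rule: infinite_finite_induct)
    case (insert x F)
    then show ?case using fps_const_add[of "[:h x:]" "[:sum h F:]"] by simp
  qed simp_all
  have "fps_act gen_op a f m = (\<Sum>i\<in>UNIV. \<Sum>j\<in>low_indices. fps_const [:\<mu> i j:] * ?w j)"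
    by (simp add: sum_zero fps_act_sum fps_act_letter)
  also have "\<dots> = (\<Sum>j\<in>low_indices. fps_const [:\<Sum>i\<in>UNIV. \<mu> i j:] * ?w j)"
    unfolding c sum_distrib_right by (rule sum.swap)
  finally show ?thesis by (simp add: sum_\<mu>)
qed

lemma gen_op_hc_ideal: "x \<in> hc_ideal \<Longrightarrow> fps_act gen_op x f m = 0"
  unfolding hc_ideal_def
  by (rule fps_act_hadic_closure)
     (rule fps_act_two_sided_ideal[of gen_op, OF hlin_gen_op gen_op_relator])

definition hc_act :: "'n hc \<Rightarrow> ('n hat_gen multiset \<Rightarrow> complex poly fps) \<Rightarrow> 'n hat_gen multiset \<Rightarrow> complex poly fps" where
  "hc_act x = fps_act gen_op (rep_hc x)"

text \<open>Two representatives differ by an element of the ideal, which acts as zero, so the choice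
  made by \<open>rep_hc\<close> does not matter.\<close>

lemma hc_act_abs: "hc_act (abs_hc x) = fps_act gen_op x"
proof (intro ext)
  fix f m
  have "rep_hc (abs_hc x) - x \<in> hc_ideal"
    using Quotient_rep_abs[OF Quotient_hc, of x] Quotient_abs_rep[OF Quotient_hc, of "abs_hc x"]
    by (metis hc.abs_eq_iff)
  then show "hc_act (abs_hc x) f m = fps_act gen_op x f m"
    using gen_op_hc_ideal[of "rep_hc (abs_hc x) - x" f m] by (simp add: hc_act_def fps_act_diff)
qed

lemma hc_act_add: "hc_act (x + y) f m = hc_act x f m + hc_act y f m"
  by (induction x rule: hc.abs_induct, induction y rule: hc.abs_induct)
     (simp add: plus_hc.abs_eq hc_act_abs fps_act_add)

lemma hc_act_zero: "hc_act 0 f m = 0"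
  using hc_act_add[of 0 0 f m] by simp

lemma hc_act_sum: "hc_act (\<Sum>j\<in>K. x j) f m = (\<Sum>j\<in>K. hc_act (x j) f m)"
  by (induction K rule: infinite_finite_induct) (simp_all add: hc_act_add hc_act_zero)

lemma hc_act_mult: "hc_act (x * y) f = hc_act x (hc_act y f)"
  by (induction x rule: hc.abs_induct, induction y rule: hc.abs_induct)
     (simp add: times_hc.abs_eq hc_act_abs fps_act_mult[of gen_op, OF hlin_gen_op])

lemma hc_act_one: "hc_act 1 f m = f m"
  by (simp add: one_hc_def hc_act_abs fps_act_one)

lemma hc_act_scale: "hc_act (hc_scale c x) f m = Abs_fps (\<lambda>k. [:fps_nth c k:]) * hc_act x f m"
  by (induction x rule: hc.abs_induct)
     (simp add: hc_scale.abs_eq hc_act_abs fps_act_mult[of gen_op, OF hlin_gen_op] fps_act_scalar)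

text \<open>The coefficients \<open>\<nu>\<close> undo the expansion by \<open>\<mu>\<close>,
  leaving a single Wick operator.\<close>

lemma hc_act_y_hat:
  assumes "j \<in> low_indices"
  shows "hc_act (hc_y_hat \<nu> j r) f m = wick (hat_bracket \<nu>) (HatY j r) f m"
proof -
  have c: "Abs_fps (\<lambda>k. [:fps_nth (fps_const a) k:]) = fps_const [:a:]" for a :: complex
    by (rule fps_ext) simp
  show ?thesis
    using hat_change_of_basis_inverse[OF module_poly_fps assms, of "\<lambda>j. wick (hat_bracket \<nu>) (HatY j r) f m"]
    by (simp add: hc_y_hat_def hc_act_sum hc_act_scale hc_y_def hc_act_abs fps_act_letter c del: fps_nth_fps_const)
qed

lemma hc_act_monomial:
  "set w \<subseteq> hat_gens \<Longrightarrow> hc_act (hc_monomial \<nu> w) f m = foldr (hat_op (hat_bracket \<nu>)) w f m"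
proof (induction w arbitrary: m)
  case Nil
  then show ?case by (simp add: hc_monomial_def hc_act_one)
next
  case (Cons a w)
  have "hc_act (hc_monomial \<nu> w) f = foldr (hat_op (hat_bracket \<nu>)) w f"
    using Cons by auto
  moreover have "hc_act (hat_value \<nu> a) g m = hat_op (hat_bracket \<nu>) a g m" for g
  proof (cases a)
    case HatC
    then show ?thesis by (simp add: hc_C_def hc_act_abs fps_act_letter)
  next
    case (HatY j r)
    then show ?thesis using Cons.prems by (auto simp: hat_gens_def hc_act_y_hat)
  qed
  ultimately show ?case
    by (simp add: hc_monomial_def hc_act_mult)
qed

text \<open>Let the relation act on the indicator function \<open>f\<close> of the noncentral
  letters of \<open>w0\<close>. Its value at the empty multiset keeps only words with these letters,
  and the powers of \<open>C\<close> tell those apart.\<close>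

lemma increasing_monomials_linearly_independent:
  assumes S: "finite S" "S \<subseteq> increasing_words"
    and zero: "(\<Sum>w\<in>S. hc_scale (c w) (hc_monomial \<nu> w)) = 0"
    and w0: "w0 \<in> S"
  shows "c w0 = 0"
proof (rule fps_ext)
  fix n
  let ?Y = "\<lambda>w. filter_mset (\<lambda>a. a \<noteq> HatC) (mset w :: 'n hat_gen multiset)"
  let ?k = "\<lambda>w. count (mset w) (HatC :: 'n hat_gen)"
  define f where "f m = (if m = ?Y w0 then 1 else 0 :: complex poly fps)" for m
  have act: "hc_act (hc_monomial \<nu> w) f {#} = fps_const ([:0, 1:] ^ ?k w) * f (?Y w)" if "w \<in> S" for w
    using that S foldr_hat_op_sorted[of w "{#}" "hat_bracket \<nu>" f]
    by (auto simp: hc_act_monomial increasing_words_altdef)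
  \<comment> \<open>The noncentral letters and the number of \<open>HatC\<close> give the content,
    and a sorted word is determined by its content.\<close>
  have inj: "w = w0" if "w \<in> S" "?Y w = ?Y w0" "?k w = ?k w0" for w
  proof -
    have "mset w = replicate_mset (?k w) HatC + ?Y w" for w :: "'n hat_gen list"
      by (rule multiset_eqI) auto
    then have "mset w = mset w0" using that by metis
    then show ?thesis
      using that w0 S by (metis (mono_tags, lifting) increasing_words_altdef mem_Collect_eq
          properties_for_sort sorted_sort_id subset_eq)
  qed
  have "0 = hc_act (\<Sum>w\<in>S. hc_scale (c w) (hc_monomial \<nu> w)) f {#}"
    by (simp add: zero hc_act_zero)
  also have "\<dots> = (\<Sum>w\<in>S. Abs_fps (\<lambda>k. [:fps_nth (c w) k:]) * (fps_const ([:0, 1:] ^ ?k w) * f (?Y w)))"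
    by (simp add: hc_act_sum hc_act_scale act)
  \<comment> \<open>The coefficient at \<open>h\<^sup>n\<close> and at the power of \<open>C\<close>
    occurring in \<open>w0\<close> isolates a single scalar.\<close>
  finally have "0 = coeff (fps_nth (\<Sum>w\<in>S. Abs_fps (\<lambda>k. [:fps_nth (c w) k:]) *
      (fps_const ([:0, 1:] ^ ?k w) * f (?Y w))) n) (?k w0)"
    by simp
  also have "\<dots> = (\<Sum>w\<in>S. coeff (fps_nth (Abs_fps (\<lambda>k. [:fps_nth (c w) k:]) *
      (fps_const ([:0, 1:] ^ ?k w) * f (?Y w))) n) (?k w0))"
    by (simp add: fps_sum_nth coeff_sum)
  also have "\<dots> = (\<Sum>w\<in>S. if w = w0 then fps_nth (c w) n else 0)"
  proof (intro sum.cong refl)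
    fix w assume w: "w \<in> S"
    have X: "[:0, 1:] ^ k = monom (1::complex) k" for k
      by (simp add: monom_altdef)
    show "coeff (fps_nth (Abs_fps (\<lambda>k. [:fps_nth (c w) k:]) *
      (fps_const ([:0, 1:] ^ ?k w) * f (?Y w))) n) (?k w0) = (if w = w0 then fps_nth (c w) n else 0)"
      using inj[OF w] by (cases "?Y w = ?Y w0") (auto simp: f_def X)
  qed
  finally show "fps_nth (c w0) n = fps_nth 0 n"
    using S w0 by simp
qed

end


section \<open>Density of the span of increasing monomials\<close>

lemma abs_hc_eqI: "x - y \<in> hc_ideal \<Longrightarrow> abs_hc x = abs_hc y"
  by (simp add: hc.abs_eq_iff)

lemma abs_hc_surj: "\<exists>y. x = abs_hc y"
  by (induction x rule: hc.abs_induct) blast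

lemma relator_in_hc_ideal: "x \<in> relators \<Longrightarrow> x \<in> hc_ideal"
proof -
  assume "x \<in> relators"
  then have "x \<in> two_sided_ideal relators"
    using two_sided_ideal_superset by blast
  moreover have "x - x = fps_X ^ n * 0" for n by simp
  ultimately show ?thesis
    unfolding hc_ideal_def hadic_closure_def by blast
qed

text \<open>Scalars sit on the empty word, the unit of the free monoid.\<close>

lemma falg_scalar_commute: "falg_scalar c * x = x * (falg_scalar c :: 'n falg)"
proof -
  have single: "Poly_Mapping.single 0 a * p = p * Poly_Mapping.single 0 a"
    for a :: complex and p :: "'n gen free_mon \<Rightarrow>\<^sub>0 complex"
    by (induction p rule: poly_mapping_add_induct) (simp_all add: mult_single mult.commute algebra_simps)
  show ?thesis
    by (rule fps_ext)
       (simp add: fps_mult_nth falg_scalar_def single atLeast0AtMost sum_atMost_reverse[of "\<lambda>i j. fps_nth x j * Poly_Mapping.single 0 (fps_nth c i)"])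
qed

lemma hc_scale_mult_left: "hc_scale c x * y = hc_scale c (x * y)"
  using abs_hc_surj[of x] abs_hc_surj[of y]
  by (auto simp: hc_scale.abs_eq times_hc.abs_eq mult.assoc)

lemma hc_scale_mult_right: "x * hc_scale c y = hc_scale c (x * y)" for x :: "'n::finite hc"
proof -
  have "falg_scalar c * (v * w) = v * (falg_scalar c * w)" for v w :: "'n falg"
    by (simp add: mult.assoc[symmetric] falg_scalar_commute[of c v])
  then show ?thesis
    using abs_hc_surj[of x] abs_hc_surj[of y]
    by (auto simp: hc_scale.abs_eq times_hc.abs_eq)
qed

lemma hc_C_commute: "hc_C * x = x * hc_C"
proof -
  obtain y where "x = abs_hc y" using abs_hc_surj by blast
  then show ?thesis
    using relator_in_hc_ideal[OF relators.central[of y]]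
    by (simp add: hc_C_def times_hc.abs_eq abs_hc_eqI)
qed

lemma hc_y_exchange:
  "hc_y i r * hc_y j s - hc_y j s * hc_y i r =
     abs_hc (eval_C (s_coeff i j s r)) - abs_hc (eval_C (s_coeff i j r s))"
proof -
  have "hc_y i r * hc_y j s + abs_hc (eval_C (s_coeff i j r s)) =
      hc_y j s * hc_y i r + abs_hc (eval_C (s_coeff i j s r))"
    using relator_in_hc_ideal[OF relators.exchange[of i r j s]]
    by (simp add: hc_y_def times_hc.abs_eq plus_hc.abs_eq abs_hc_eqI)
  then show ?thesis by (simp add: algebra_simps)
qed

lemma abs_hc_sum: "abs_hc (\<Sum>j\<in>K. x j) = (\<Sum>j\<in>K. abs_hc (x j))"
  by (induction K rule: infinite_finite_induct) (simp_all add: zero_hc_def plus_hc.abs_eq[symmetric])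

lemma sum_hc_y: "(\<Sum>i\<in>UNIV. hc_y i r) = 0"
proof -
  have "(\<Sum>i\<in>UNIV. hc_y i r) = abs_hc (\<Sum>i\<in>UNIV. letter (GenY i r))"
    by (simp add: hc_y_def abs_hc_sum)
  also have "\<dots> = abs_hc 0"
    using relator_in_hc_ideal[OF relators.sum_zero[of r]] by (intro abs_hc_eqI) simp
  finally show ?thesis by (simp add: zero_hc_def)
qed

fun hc_gen :: "'n::finite gen \<Rightarrow> 'n hc" where
  "hc_gen GenC = hc_C"
| "hc_gen (GenY i r) = hc_y i r"

lemma abs_hc_word:
  "abs_hc (fps_const (Poly_Mapping.single (Word gs) c)) = hc_scale (fps_const c) (prod_list (map hc_gen gs))"
  for gs :: "'n::finite gen list"
proof (induction gs)
  case Nil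
  have "fps_const (Poly_Mapping.single (Word []) c) = (falg_scalar (fps_const c) :: 'n falg)"
    by (rule fps_ext) (simp add: falg_scalar_def zero_free_mon_def)
  then show ?case by (simp add: one_hc_def hc_scale.abs_eq)
next
  case (Cons g gs)
  have "fps_const (Poly_Mapping.single (Word (g # gs)) c) = letter g * fps_const (Poly_Mapping.single (Word gs) c)"
    by (simp add: letter_def mult_single plus_free_mon_def)
  moreover have "abs_hc (letter g) = hc_gen g"
    by (cases g) (simp_all add: hc_C_def hc_y_def)
  ultimately show ?case
    using Cons.IH by (simp add: times_hc.abs_eq[symmetric] hc_scale_mult_right)
qed

lemma fps_truncation:
  "f = (\<Sum>k<n. fps_X ^ k * fps_const (fps_nth f k)) + fps_X ^ n * fps_shift n f" for f :: "'a::ring_1 fps"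
proof (induction n)
  case (Suc n)
  have "fps_shift n f = fps_const (fps_nth f n) + fps_X * fps_shift (Suc n) f"
    by (rule fps_ext) (simp add: fps_X_mult_nth split: nat.split)
  then have "fps_X ^ n * fps_shift n f = fps_X ^ n * fps_const (fps_nth f n) + fps_X ^ Suc n * fps_shift (Suc n) f"
    by (simp only: distrib_left power_Suc2 mult.assoc)
  with Suc show ?case by (simp add: add.assoc)
qed simp

section \<open>The \<open>h\<close>-adic closure of a submodule\<close>

definition hc_closure :: "'n::finite hc set \<Rightarrow> 'n hc set" where
  "hc_closure V = {x. \<forall>n. \<exists>y\<in>V. \<exists>z. x - y = hc_scale (fps_X ^ n) z}"

lemma hc_closure_superset: "V \<subseteq> hc_closure V"
  unfolding hc_closure_def by (auto intro!: exI[of _ 0] bexI)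

lemma subspace_hc_closure:
  assumes "hc.subspace V"
  shows "hc.subspace (hc_closure V)"
  unfolding hc.subspace_def
proof (intro conjI ballI allI)
  show "0 \<in> hc_closure V"
    using hc_closure_superset hc.subspace_0[OF assms] by blast
next
  fix x y assume "x \<in> hc_closure V" "y \<in> hc_closure V"
  then have "\<exists>u\<in>V. \<exists>z. x + y - u = hc_scale (fps_X ^ n) z" for n
  proof -
    obtain u w z t where "u \<in> V" "w \<in> V" "x - u = hc_scale (fps_X ^ n) z" "y - w = hc_scale (fps_X ^ n) t"
      using \<open>x \<in> hc_closure V\<close> \<open>y \<in> hc_closure V\<close> unfolding hc_closure_def by blast
    then have "u + w \<in> V" "x + y - (u + w) = hc_scale (fps_X ^ n) (z + t)"
      using hc.subspace_add[OF assms] by (auto simp: hc.scale_right_distrib algebra_simps)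
    then show ?thesis by blast
  qed
  then show "x + y \<in> hc_closure V" by (simp add: hc_closure_def)
next
  fix c x assume x: "x \<in> hc_closure V"
  have "\<exists>u\<in>V. \<exists>z. hc_scale c x - u = hc_scale (fps_X ^ n) z" for n
  proof -
    obtain u z where "u \<in> V" "x - u = hc_scale (fps_X ^ n) z"
      using x unfolding hc_closure_def by blast
    then have "hc_scale c u \<in> V" "hc_scale c x - hc_scale c u = hc_scale (fps_X ^ n) (hc_scale c z)"
      using hc.subspace_scale[OF assms]
      by (auto simp: hc.scale_right_diff_distrib[symmetric] mult.commute)
    then show ?thesis by blast
  qed
  then show "hc_scale c x \<in> hc_closure V" by (simp add: hc_closure_def)
qed

text \<open>The closure is itself closed: both approximation errors are multiples of
  \<open>h\<^sup>n\<close>, hence so is their sum.\<close>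

lemma hc_closureI:
  assumes "hc.subspace V" "\<And>n. \<exists>y\<in>hc_closure V. \<exists>z. x - y = hc_scale (fps_X ^ n) z"
  shows "x \<in> hc_closure V"
  unfolding hc_closure_def
proof (intro CollectI allI)
  fix n
  obtain y z where y: "y \<in> hc_closure V" "x - y = hc_scale (fps_X ^ n) z" using assms(2) by blast
  then obtain u t where u: "u \<in> V" "y - u = hc_scale (fps_X ^ n) t" unfolding hc_closure_def by blast
  have "x - u = hc_scale (fps_X ^ n) (z + t)"
    using y(2) u(2) by (simp add: hc.scale_right_distrib algebra_simps)
  then show "\<exists>u\<in>V. \<exists>z. x - u = hc_scale (fps_X ^ n) z" using u(1) by blast
qed

text \<open>Truncating \<open>f\<close> at \<open>h\<^sup>n\<close> leaves a finite combination of
  its coefficients and an error divisible by \<open>h\<^sup>n\<close>. The outer factors allow use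
  in the middle of a product.\<close>

lemma hc_closure_coeffwise:
  assumes V: "hc.subspace V" and f: "\<And>k. x * abs_hc (fps_const (fps_nth f k)) * y \<in> hc_closure V"
  shows "x * abs_hc f * y \<in> hc_closure V"
proof (rule hc_closureI[OF V])
  fix n
  let ?s = "\<Sum>k<n. hc_scale (fps_X ^ k) (abs_hc (fps_const (fps_nth f k)))"
  have "abs_hc f = ?s + hc_scale (fps_X ^ n) (abs_hc (fps_shift n f))"
    by (subst fps_truncation[of f n])
       (simp add: plus_hc.abs_eq[symmetric] abs_hc_sum hc_scale.abs_eq falg_scalar_simps)
  then have "x * abs_hc f * y - x * ?s * y = hc_scale (fps_X ^ n) (x * abs_hc (fps_shift n f) * y)"
    by (simp add: distrib_left distrib_right hc_scale_mult_left hc_scale_mult_right)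
  moreover have "x * ?s * y \<in> hc_closure V"
    unfolding sum_distrib_left sum_distrib_right hc_scale_mult_left hc_scale_mult_right
    by (intro hc.subspace_sum hc.subspace_scale subspace_hc_closure V f)
  ultimately show "\<exists>y'\<in>hc_closure V. \<exists>z. x * abs_hc f * y - y' = hc_scale (fps_X ^ n) z" by blast
qed

section \<open>Reordering words modulo shorter ones\<close>

text \<open>Insertion sort only exchanges neighbours. Restricting \<open>swap\<close> to words of
  content \<open>M\<close> fixes their length, so that \<open>swap\<close> can be proved inside an
  induction on length.\<close>

lemma sorted_by_adjacent_swaps:
  fixes R :: "'a::linorder list \<Rightarrow> 'a list \<Rightarrow> bool"
  assumes refl: "\<And>xs. R xs xs" and trans: "\<And>xs ys zs. R xs ys \<Longrightarrow> R ys zs \<Longrightarrow> R xs zs"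
    and swap: "\<And>p a b q. mset (p @ a # b # q) = M \<Longrightarrow> R (p @ a # b # q) (p @ b # a # q)"
    and "mset xs = M"
  shows "R xs (sort xs)"
proof -
  have insort: "R (p @ a # xs) (p @ insort a xs)" if "mset (p @ a # xs) = M" for p a xs
    using that
  proof (induction xs arbitrary: p)
    case (Cons b xs)
    have "R (p @ a # b # xs) (p @ b # a # xs)"
      using Cons.prems by (intro swap)
    moreover have "R ((p @ [b]) @ a # xs) ((p @ [b]) @ insort a xs)"
      using Cons.prems by (intro Cons.IH) (simp add: add_mset_commute)
    ultimately show ?case using trans refl by auto
  qed (simp add: refl)
  have "R (p @ xs) (p @ sort xs)" if "mset (p @ xs) = M" for p
    using that
  proof (induction xs arbitrary: p)
    case (Cons a xs)
    have "R ((p @ [a]) @ xs) ((p @ [a]) @ sort xs)"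
      using Cons.prems by (intro Cons.IH) simp
    moreover have "R (p @ a # sort xs) (p @ insort a (sort xs))"
      using Cons.prems by (intro insort) simp
    ultimately show ?case using trans by simp
  qed (simp add: refl)
  from this[of "[]"] show ?thesis using \<open>mset xs = M\<close> by simp
qed

context
  fixes \<nu> :: "'n::{finite,linorder} \<Rightarrow> 'n \<Rightarrow> complex"
begin

abbreviation increasing_closure :: "'n hc set" where
  "increasing_closure \<equiv> hc_closure (hc.span (hc_monomial \<nu> ` increasing_words))"

lemma subspace_increasing_closure: "hc.subspace increasing_closure"
  by (intro subspace_hc_closure hc.subspace_span)

text \<open>\<open>HatC\<close> is the least letter, so putting it in front keeps a word
  increasing.\<close>

lemma hc_C_mult_increasing_closure:
  assumes "x \<in> increasing_closure"
  shows "hc_C * x \<in> increasing_closure"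
proof -
  let ?V = "hc.span (hc_monomial \<nu> ` increasing_words)"
  have V: "hc_C * v \<in> ?V" if "v \<in> ?V" for v
    using that
  proof (induction rule: hc.span_induct_alt)
    case (step c v w)
    then obtain ms where ms: "ms \<in> increasing_words" "v = hc_monomial \<nu> ms" by blast
    then have "HatC # ms \<in> increasing_words"
      by (auto simp: increasing_words_altdef HatC_le hat_gens_def)
    moreover have "hc_C * v = hc_monomial \<nu> (HatC # ms)"
      using ms by (simp add: hc_monomial_def)
    ultimately have "hc_C * v \<in> ?V"
      by (auto intro: hc.span_base)
    then show ?case using step
      by (simp add: distrib_left hc_scale_mult_right hc.span_add hc.span_scale)
  qed (simp add: hc.span_zero)
  show ?thesis
    unfolding hc_closure_def
  proof (intro CollectI allI)
    fix n
    obtain v z where v: "v \<in> ?V" "x - v = hc_scale (fps_X ^ n) z"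
      using assms unfolding hc_closure_def by blast
    then have "hc_C * x - hc_C * v = hc_scale (fps_X ^ n) (hc_C * z)"
      by (simp add: right_diff_distrib[symmetric] hc_scale_mult_right)
    then show "\<exists>v\<in>?V. \<exists>z. hc_C * x - v = hc_scale (fps_X ^ n) z"
      using V[OF v(1)] by blast
  qed
qed

text \<open>Each power of the central \<open>C\<close> moves to the front, where
  \<open>hc_C_mult_increasing_closure\<close> applies.\<close>

lemma eval_C_mult_increasing_closure:
  assumes "x * y \<in> increasing_closure"
  shows "x * abs_hc (eval_C p) * y \<in> increasing_closure"
proof (rule hc_closure_coeffwise)
  fix k
  have C: "x * hc_C ^ m * y \<in> increasing_closure" for m
  proof (induction m)
    case (Suc m)
    have "x * hc_C ^ Suc m * y = hc_C * (x * hc_C ^ m * y)"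
      by (simp add: mult.assoc[symmetric] hc_C_commute[of x])
    then show ?case using Suc hc_C_mult_increasing_closure by simp
  qed (use assms in simp)
  have "fps_const (\<Sum>j\<in>K. q j) = (\<Sum>j\<in>K. fps_const (q j))"
    for K :: "nat set" and q :: "nat \<Rightarrow> 'n gen free_mon \<Rightarrow>\<^sub>0 complex"
    by (rule fps_ext) (simp add: fps_sum_nth)
  then show "x * abs_hc (fps_const (fps_nth (eval_C p) k)) * y \<in> increasing_closure"
    unfolding eval_C_def fps_nth_Abs_fps
    by (simp only: abs_hc_sum abs_hc_word sum_distrib_left sum_distrib_right hc_scale_mult_left
        hc_scale_mult_right map_replicate prod_list_replicate hc_gen.simps)
       (intro hc.subspace_sum hc.subspace_scale subspace_increasing_closure C)
qed (rule hc.subspace_span)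

text \<open>By bilinearity and \<open>hc_y_exchange\<close> the commutator is a combination of
  images of \<open>eval_C\<close>, which the preceding lemma absorbs.\<close>

lemma hc_y_hat_commutator_mult_increasing_closure:
  assumes "x * y \<in> increasing_closure"
  shows "x * (hc_y_hat \<nu> j r * hc_y_hat \<nu> k s - hc_y_hat \<nu> k s * hc_y_hat \<nu> j r) * y \<in> increasing_closure"
proof -
  have "hc_y_hat \<nu> j r * hc_y_hat \<nu> k s =
      (\<Sum>i\<in>{..j}. \<Sum>l\<in>{..k}. hc_scale (fps_const (\<nu> i j)) (hc_scale (fps_const (\<nu> l k)) (hc_y i r * hc_y l s)))"
    by (simp only: hc_y_hat_def sum_product hc_scale_mult_left hc_scale_mult_right)
       (simp only: hc.scale_left_commute)
  moreover have "hc_y_hat \<nu> k s * hc_y_hat \<nu> j r =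
      (\<Sum>i\<in>{..j}. \<Sum>l\<in>{..k}. hc_scale (fps_const (\<nu> i j)) (hc_scale (fps_const (\<nu> l k)) (hc_y l s * hc_y i r)))"
    by (simp only: hc_y_hat_def sum_product hc_scale_mult_left hc_scale_mult_right) (rule sum.swap)
  ultimately have "hc_y_hat \<nu> j r * hc_y_hat \<nu> k s - hc_y_hat \<nu> k s * hc_y_hat \<nu> j r =
      (\<Sum>i\<in>{..j}. \<Sum>l\<in>{..k}. hc_scale (fps_const (\<nu> i j)) (hc_scale (fps_const (\<nu> l k))
        (abs_hc (eval_C (s_coeff i l s r)) - abs_hc (eval_C (s_coeff i l r s)))))"
    by (simp only: sum_subtractf[symmetric] hc.scale_right_diff_distrib[symmetric] hc_y_exchange)
  then show ?thesis
    by (simp only: sum_distrib_left sum_distrib_right hc_scale_mult_left hc_scale_mult_right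
        right_diff_distrib left_diff_distrib)
       (intro hc.subspace_sum hc.subspace_scale hc.subspace_diff subspace_increasing_closure
          eval_C_mult_increasing_closure assms)
qed

text \<open>Induction on the length: exchanging two neighbours between \<open>p\<close> and
  \<open>q\<close> costs a commutator, and the remaining word \<open>p @ q\<close> is
  shorter.\<close>

lemma hc_monomial_in_increasing_closure:
  "set w \<subseteq> hat_gens \<Longrightarrow> hc_monomial \<nu> w \<in> increasing_closure"
proof (induction "length w" arbitrary: w rule: less_induct)
  case less
  \<comment> \<open>Congruence modulo the closure, the relation fed to the sorting lemma.\<close>
  define R where "R u v \<longleftrightarrow> hc_monomial \<nu> u - hc_monomial \<nu> v \<in> increasing_closure" for u v
  have append: "hc_monomial \<nu> (u @ v) = hc_monomial \<nu> u * hc_monomial \<nu> v" for u v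
    by (simp add: hc_monomial_def)
  have "R w (sort w)"
  proof (rule sorted_by_adjacent_swaps[of R "mset w"])
    show "R u u" for u
      by (simp add: R_def hc.subspace_0[OF subspace_increasing_closure])
    show "R u t" if "R u v" "R v t" for u v t
      using hc.subspace_add[OF subspace_increasing_closure, OF that[unfolded R_def]]
      by (simp add: R_def)
    show "R (p @ a # b # q) (p @ b # a # q)" if M: "mset (p @ a # b # q) = mset w" for p a b q
    proof -
      have eq: "hc_monomial \<nu> (p @ a # b # q) - hc_monomial \<nu> (p @ b # a # q) = hc_monomial \<nu> p *
          (hat_value \<nu> a * hat_value \<nu> b - hat_value \<nu> b * hat_value \<nu> a) * hc_monomial \<nu> q"
        unfolding append by (simp add: hc_monomial_def algebra_simps)
      show ?thesis
      proof (cases "a = HatC \<or> b = HatC")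
        case True
        then have "hat_value \<nu> a * hat_value \<nu> b = hat_value \<nu> b * hat_value \<nu> a"
          by (auto simp: hc_C_commute)
        then show ?thesis
          by (simp add: R_def eq hc.subspace_0[OF subspace_increasing_closure])
      next
        case False
        then obtain j r k s where ab: "a = HatY j r" "b = HatY k s"
          by (cases a; cases b) auto
        have "length (p @ q) < length w" "set (p @ q) \<subseteq> hat_gens"
          using mset_eq_length[OF M] mset_eq_setD[OF M] less.prems by auto
        then have "hc_monomial \<nu> p * hc_monomial \<nu> q \<in> increasing_closure"
          using less.hyps[of "p @ q"] by (simp add: append)
        then show ?thesis
          unfolding R_def eq unfolding ab
          by (simp add: hc_y_hat_commutator_mult_increasing_closure)
      qed
    qed
  qed simp
  moreover have "sort w \<in> increasing_words"
    using less.prems by (simp add: increasing_words_altdef)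
  then have "hc_monomial \<nu> (sort w) \<in> increasing_closure"
    by (rule subsetD[OF hc_closure_superset hc.span_base[OF imageI]])
  ultimately have "(hc_monomial \<nu> w - hc_monomial \<nu> (sort w)) + hc_monomial \<nu> (sort w) \<in> increasing_closure"
    unfolding R_def by (rule hc.subspace_add[OF subspace_increasing_closure])
  then show ?case by simp
qed

end

section \<open>Density and the basis property\<close>

context hat_coeffs
begin

lemma hc_y_eq_hat: "hc_y i r = (\<Sum>j\<in>low_indices. hc_scale (fps_const (\<mu> i j)) (hc_y_hat \<nu> j r))"
  using hat_change_of_basis[OF module_hc sum_hc_y, of i] by (simp add: hc_y_hat_def)

text \<open>\<open>w\<close> collects the part already rewritten in hatted letters; the next letter
  is expanded and appended at its right end.\<close>

lemma word_in_increasing_closure: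
  "set w \<subseteq> hat_gens \<Longrightarrow> hc_monomial \<nu> w * prod_list (map hc_gen gs) \<in> increasing_closure \<nu>"
proof (induction gs arbitrary: w)
  case Nil
  then show ?case by (simp add: hc_monomial_in_increasing_closure)
next
  case (Cons g gs)
  have snoc: "hc_monomial \<nu> w * (hat_value \<nu> a * x) = hc_monomial \<nu> (w @ [a]) * x" for a x
    by (simp add: hc_monomial_def mult.assoc)
  show ?case
  proof (cases g)
    case GenC
    then show ?thesis
      using snoc[of HatC] Cons.IH[of "w @ [HatC]"] Cons.prems by (simp add: hat_gens_def)
  next
    case (GenY i r)
    have "hc_monomial \<nu> w * prod_list (map hc_gen (g # gs)) = (\<Sum>j\<in>low_indices.
        hc_scale (fps_const (\<mu> i j)) (hc_monomial \<nu> w * (hat_value \<nu> (HatY j r) * prod_list (map hc_gen gs))))"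
      by (simp add: GenY hc_y_eq_hat sum_distrib_left sum_distrib_right hc_scale_mult_left hc_scale_mult_right)
    also have "\<dots> \<in> increasing_closure \<nu>"
      unfolding snoc
      by (intro hc.subspace_sum hc.subspace_scale subspace_increasing_closure Cons.IH)
         (use Cons.prems in \<open>auto simp: hat_gens_def\<close>)
    finally show ?thesis .
  qed
qed

text \<open>A series reduces to its coefficients by \<open>hc_closure_coeffwise\<close>, and a
  coefficient to words by additivity.\<close>

lemma increasing_closure_UNIV: "x \<in> increasing_closure \<nu>"
proof -
  have const: "abs_hc (fps_const p) \<in> increasing_closure \<nu>" for p
  proof (induction p rule: poly_mapping_add_induct)
    case zero
    then show ?case
      using hc.subspace_0[OF subspace_increasing_closure] by (simp add: zero_hc_def)
  next
    case (single v c)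
    obtain gs where "v = Word gs" by (cases v)
    moreover have "prod_list (map hc_gen gs) \<in> increasing_closure \<nu>"
      using word_in_increasing_closure[of "[]" gs] by (simp add: hc_monomial_def[of \<nu> "[]"])
    ultimately show ?case
      by (simp add: abs_hc_word hc.subspace_scale[OF subspace_increasing_closure])
  next
    case (add p q)
    then show ?case
      using hc.subspace_add[OF subspace_increasing_closure]
      by (simp add: plus_hc.abs_eq[symmetric] fps_const_add[symmetric] del: fps_const_add)
  qed
  have "1 * abs_hc f * 1 \<in> increasing_closure \<nu>" for f
    by (rule hc_closure_coeffwise[OF hc.subspace_span]) (simp add: const)
  then show ?thesis using abs_hc_surj[of x] by auto
qed

text \<open>Equal values at different words would be a linear relation with coefficients 1 and
  -1.\<close>

lemma inj_on_hc_monomial: "inj_on (hc_monomial \<nu>) increasing_words"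
proof (rule inj_onI, rule ccontr)
  fix v w assume *: "v \<in> increasing_words" "w \<in> increasing_words"
    "hc_monomial \<nu> v = hc_monomial \<nu> w" "v \<noteq> w"
  have "(if v = v then 1 else - 1) = (0 :: complex fps)"
    using * by (intro increasing_monomials_linearly_independent[of "{v, w}" "\<lambda>u. if u = v then 1 else - 1" v]) auto
  then show False by simp
qed

lemma increasing_monomials_topological_basis:
  "hc_topological_basis increasing_words (hc_monomial \<nu>)"
  unfolding hc_topological_basis_def
proof (intro conjI inj_on_hc_monomial)
  show "hc.independent (hc_monomial \<nu> ` increasing_words)"
    unfolding hc.independent_explicit_module
  proof (intro allI impI)
    fix t u v
    assume t: "finite t" "t \<subseteq> hc_monomial \<nu> ` increasing_words" "(\<Sum>v\<in>t. hc_scale (u v) v) = 0" "v \<in> t"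
    \<comment> \<open>Independence is stated for the set of values; by injectivity a relation there
      becomes one indexed by words.\<close>
    then obtain S where S: "S \<subseteq> increasing_words" "t = hc_monomial \<nu> ` S"
      by (auto simp: subset_image_iff)
    have inj: "inj_on (hc_monomial \<nu>) S"
      using S(1) by (rule inj_on_subset[OF inj_on_hc_monomial])
    obtain w where w: "w \<in> S" "v = hc_monomial \<nu> w"
      using S t by blast
    have "finite S" using t(1) S(2) inj by (simp add: finite_image_iff)
    then show "u v = 0"
      using increasing_monomials_linearly_independent[of S "\<lambda>w. u (hc_monomial \<nu> w)" w] S w t(3) inj
      by (simp add: sum.reindex)
  qed
  show "hc_dense (hc.span (hc_monomial \<nu> ` increasing_words))"
    using increasing_closure_UNIV by (simp add: hc_dense_def hc_closure_def)
qed

end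

theorem theorem3p3:
  fixes \<nu> :: "'n::{finite,linorder} \<Rightarrow> 'n \<Rightarrow> complex"
  assumes "2 \<le> CARD('n)"
    and "orthonormal_basis_coeffs \<nu>"
  shows "hc_topological_basis increasing_words (hc_monomial \<nu>)"
proof -
  obtain \<mu> \<kappa> where "hat_coeffs \<nu> \<mu> \<kappa>"
    using orthonormal_basis_coeffs_imp_hat_coeffs[OF assms(2)] .
  then interpret hat_coeffs \<nu> \<mu> \<kappa> .
  show ?thesis by (rule increasing_monomials_topological_basis)
qed

end
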